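(* There is a polynomial time reduction of the graph isomorphism problem to the lattice isomorphism problem, where the two decision problems are as follows. Graph isomorphism problem. Input: graphs $G = (V, E_G)$ and $H = (V, E_H)$. Output: Yes, if there is a permutation $\sigma : V \to V$ such that for all $v, w \in V$ we have $\{v,w\} \in E_G$ if and only if $\{\sigma(v), \sigma(w)\} \in E_H$; No otherwise. Lattice isomorphism problem. Input: positive integers $m, n$ and matrices $B, B' \in \mathbb{Q}^{m\times n}$ of rank $n$. Output: Yes, if there is an orthogonal transformation $O$ of $\mathbb{R}^m$ such that $O B \mathbb{Z}^n = B' \mathbb{Z}^n$; No otherwise.
   Context: Graphs are finite and simple, and rational inputs are encoded in binary in the standard way. A polynomial time reduction of one decision problem to another is a polynomial-time computable map from instances of the first to instances of the second that preserves the Yes/No answer. For a matrix $B \in \mathbb{Q}^{m \times n}$ of rank $n$, $B\mathbb{Z}^n \subseteq \mathbb{R}^m$ is the lattice having the columns of $B$ as a basis. *)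

theory Defs
  imports
    "Jordan_Normal_Form.DL_Rank"
    "HOL-Combinatorics.Permutations"
    "HOL-Computational_Algebra.Polynomial"
begin

section \<open>Deterministic multi-tape Turing machines\<close>

text \<open>
  Tapes are infinite in both directions; a tape is its contents together with the head position.
  Tape symbols are the numbers below \<open>num_symbols\<close>, where 0 is the blank.
  The states are \<open>0, \<dots>, num_states - 1\<close>, the initial state is 0, and the number
  \<open>num_states\<close> itself stands for the halting state. Only the finitely many values of \<open>trans\<close>
  on states and tuples of symbols in these ranges matter.
\<close>

datatype move = MoveL | Stay | MoveR

record turing_machine =
  num_tapes :: nat
  num_symbols :: nat
  num_states :: nat
  trans :: "nat \<Rightarrow> nat list \<Rightarrow> nat \<times> (nat \<times> move) list"

type_synonym tape = "(int \<Rightarrow> nat) \<times> int"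
type_synonym config = "nat \<times> tape list"

datatype symbol = Zero | One | Minus | Slash | Comma | Semicolon

fun symbol_code :: "symbol \<Rightarrow> nat" where
  "symbol_code Zero = 1"
| "symbol_code One = 2"
| "symbol_code Minus = 3"
| "symbol_code Slash = 4"
| "symbol_code Comma = 5"
| "symbol_code Semicolon = 6"

definition wf_turing_machine :: "turing_machine \<Rightarrow> bool" where
  "wf_turing_machine M \<longleftrightarrow>
     num_tapes M \<ge> 2 \<and> (\<forall>s. symbol_code s < num_symbols M) \<and>
     (\<forall>q < num_states M. \<forall>xs. length xs = num_tapes M \<and> set xs \<subseteq> {..<num_symbols M} \<longrightarrow>
        (case trans M q xs of (q', as) \<Rightarrow>
           q' \<le> num_states M \<and> length as = num_tapes M \<and> fst ` set as \<subseteq> {..<num_symbols M}))"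

fun move_head :: "move \<Rightarrow> int \<Rightarrow> int" where
  "move_head MoveL h = h - 1"
| "move_head Stay h = h"
| "move_head MoveR h = h + 1"

fun read_tape :: "tape \<Rightarrow> nat" where
  "read_tape (c, h) = c h"

fun act_on_tape :: "nat \<times> move \<Rightarrow> tape \<Rightarrow> tape" where
  "act_on_tape (s, d) (c, h) = (c(h := s), move_head d h)"

fun tm_step :: "turing_machine \<Rightarrow> config \<Rightarrow> config" where
  "tm_step M (q, ts) =
     (if q < num_states M then
        (case trans M q (map read_tape ts) of (q', as) \<Rightarrow> (q', map2 act_on_tape as ts))
      else (q, ts))"

definition word_contents :: "symbol list \<Rightarrow> int \<Rightarrow> nat" where
  "word_contents w i = (if 0 \<le> i \<and> nat i < length w then symbol_code (w ! nat i) else 0)"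

definition tm_init :: "turing_machine \<Rightarrow> symbol list \<Rightarrow> config" where
  "tm_init M w =
     (0, (word_contents w, 0) # replicate (num_tapes M - 1) (word_contents [], 0))"

text \<open>The input is on tape 0; the output is everything written on tape 1.\<close>

definition tm_computes_within :: "turing_machine \<Rightarrow> symbol list \<Rightarrow> symbol list \<Rightarrow> nat \<Rightarrow> bool" where
  "tm_computes_within M w out b \<longleftrightarrow>
     (\<exists>t \<le> b. case (tm_step M ^^ t) (tm_init M w) of (q, ts) \<Rightarrow>
        q = num_states M \<and> fst (ts ! 1) = word_contents out)"


section \<open>Polynomial time reductions\<close>

record 'a decision_problem =
  instances :: "'a set"
  yes_instance :: "'a \<Rightarrow> bool"
  encoding :: "'a \<Rightarrow> symbol list"

definition polynomial_time_computable ::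
  "'a decision_problem \<Rightarrow> 'b decision_problem \<Rightarrow> ('a \<Rightarrow> 'b) \<Rightarrow> bool" where
  "polynomial_time_computable P Q f \<longleftrightarrow>
     (\<exists>M. \<exists>p :: nat poly. wf_turing_machine M \<and>
        (\<forall>x \<in> instances P.
           tm_computes_within M (encoding P x) (encoding Q (f x))
             (poly p (length (encoding P x)))))"

definition polynomial_time_reduction ::
  "'a decision_problem \<Rightarrow> 'b decision_problem \<Rightarrow> ('a \<Rightarrow> 'b) \<Rightarrow> bool" where
  "polynomial_time_reduction P Q f \<longleftrightarrow>
     f ` instances P \<subseteq> instances Q \<and>
     polynomial_time_computable P Q f \<and>
     (\<forall>x \<in> instances P. yes_instance P x \<longleftrightarrow> yes_instance Q (f x))"


section \<open>Graph isomorphism\<close>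

text \<open>
  The vertex set of a graph is \<open>{..<n}\<close> and its edges are two-element subsets of the vertex set.
  A graph is encoded by its adjacency matrix, row by row.
\<close>

definition simple_graph :: "nat \<Rightarrow> nat set set \<Rightarrow> bool" where
  "simple_graph n E \<longleftrightarrow> (\<forall>e \<in> E. e \<subseteq> {..<n} \<and> card e = 2)"

definition isomorphic_graphs :: "nat \<Rightarrow> nat set set \<Rightarrow> nat set set \<Rightarrow> bool" where
  "isomorphic_graphs n EG EH \<longleftrightarrow>
     (\<exists>\<sigma>. \<sigma> permutes {..<n} \<and> (\<forall>v<n. \<forall>w<n. {v, w} \<in> EG \<longleftrightarrow> {\<sigma> v, \<sigma> w} \<in> EH))"

definition encode_graph :: "nat \<Rightarrow> nat set set \<Rightarrow> symbol list" where
  "encode_graph n E =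
     concat (map (\<lambda>v. map (\<lambda>w. if {v, w} \<in> E then One else Zero) [0..<n] @ [Comma]) [0..<n])"

definition graph_isomorphism :: "(nat \<times> nat set set \<times> nat set set) decision_problem" where
  "graph_isomorphism =
     \<lparr>instances = {(n, EG, EH). simple_graph n EG \<and> simple_graph n EH},
      yes_instance = (\<lambda>(n, EG, EH). isomorphic_graphs n EG EH),
      encoding = (\<lambda>(n, EG, EH). encode_graph n EG @ [Semicolon] @ encode_graph n EH)\<rparr>"


section \<open>Lattice isomorphism\<close>

definition lattice_with_basis :: "rat mat \<Rightarrow> real vec set" where
  "lattice_with_basis B =
     {map_mat of_rat B *\<^sub>v map_vec of_int x | x :: int vec. x \<in> carrier_vec (dim_col B)}"

text \<open>The library's \<open>orthogonal_mat\<close> asks for orthogonal columns without normalising them.\<close>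

definition orthogonal_transformation_mat :: "nat \<Rightarrow> real mat \<Rightarrow> bool" where
  "orthogonal_transformation_mat m U \<longleftrightarrow>
     U \<in> carrier_mat m m \<and> transpose_mat U * U = 1\<^sub>m m"

definition isomorphic_lattices :: "nat \<Rightarrow> rat mat \<Rightarrow> rat mat \<Rightarrow> bool" where
  "isomorphic_lattices m B B' \<longleftrightarrow>
     (\<exists>U. orthogonal_transformation_mat m U \<and>
        (\<lambda>v. U *\<^sub>v v) ` lattice_with_basis B = lattice_with_basis B')"

text \<open>Most significant bit first, without leading zeros.\<close>

fun encode_nat :: "nat \<Rightarrow> symbol list" where
  "encode_nat k =
     (if k < 2 then [] else encode_nat (k div 2)) @ [if odd k then One else Zero]"

declare encode_nat.simps [simp del]

definition encode_int :: "int \<Rightarrow> symbol list" where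
  "encode_int z = (if z < 0 then [Minus] else []) @ encode_nat (nat \<bar>z\<bar>)"

text \<open>\<open>quotient_of\<close> gives the reduced fraction with positive denominator.\<close>

definition encode_rat :: "rat \<Rightarrow> symbol list" where
  "encode_rat r = (case quotient_of r of (a, b) \<Rightarrow> encode_int a @ [Slash] @ encode_int b)"

definition encode_mat :: "rat mat \<Rightarrow> symbol list" where
  "encode_mat B = concat (map (\<lambda>r. encode_rat r @ [Comma]) (concat (mat_to_list B)))"

definition lattice_isomorphism :: "(nat \<times> nat \<times> rat mat \<times> rat mat) decision_problem" where
  "lattice_isomorphism =
     \<lparr>instances = {(m, n, B, B'). m > 0 \<and> n > 0 \<and>
        B \<in> carrier_mat m n \<and> B' \<in> carrier_mat m n \<and>
        vec_space.rank m B = n \<and> vec_space.rank m B' = n},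
      yes_instance = (\<lambda>(m, n, B, B'). isomorphic_lattices m B B'),
      encoding = (\<lambda>(m, n, B, B').
        encode_nat m @ [Semicolon] @ encode_nat n @ [Semicolon] @
        encode_mat B @ [Semicolon] @ encode_mat B')\<rparr>"

end

theory Submission
  imports Defs
begin

text \<open>
  A graph \<open>G\<close> on \<open>n > 0\<close> vertices with adjacency matrix \<open>A\<close> is mapped to the lattice with basis
  \<open>B = k I + A\<close>, where \<open>k = 2 ^ (n + 1) \<ge> 4 n\<close>. Diagonal dominance gives
  \<open>16 |B y|\<^sup>2 \<ge> 9 k\<^sup>2 |y|\<^sup>2\<close>, while the columns of \<open>B\<close> have squared length at most \<open>k\<^sup>2 + n\<close>.
  Hence an isometry between two such lattices maps each column, up to sign, to a column, and this
  is a permutation of the vertices. It preserves the absolute values of the Gram entries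
  \<open>2 k A\<^sub>i\<^sub>j + (A\<^sup>2)\<^sub>i\<^sub>j\<close>, and since \<open>0 \<le> (A\<^sup>2)\<^sub>i\<^sub>j \<le> n < 2 k\<close> these determine the edges.

  The scale is a power of two so that a Turing machine can write the basis without arithmetic,
  replacing each symbol of the adjacency matrix by the encoding of a number; only the dimension
  \<open>n\<close> has to be converted to binary, with a counter.
\<close>

section \<open>The lattice of a graph\<close>

text \<open>Polymorphic in the entries: the rational instance is the output of the reduction, the
  real one carries the geometry.\<close>

definition graph_matrix :: "nat \<Rightarrow> nat set set \<Rightarrow> 'a :: comm_ring_1 mat" where
  "graph_matrix n E =
     mat n n (\<lambda>(i, j). if i = j then 2 ^ (n + 1) else of_bool ({i, j} \<in> E))"

lemma graph_matrix_carrier [simp]: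
  "graph_matrix n E \<in> carrier_mat n n" "dim_row (graph_matrix n E) = n"
  "dim_col (graph_matrix n E) = n"
  by (simp_all add: graph_matrix_def)

lemma graph_matrix_index:
  "i < n \<Longrightarrow> j < n \<Longrightarrow>
    graph_matrix n E $$ (i, j) = (if i = j then 2 ^ (n + 1) else of_bool ({i, j} \<in> E))"
  by (simp add: graph_matrix_def)

lemma of_rat_graph_matrix:
  "map_mat of_rat (graph_matrix n E) = (graph_matrix n E :: 'a :: field_char_0 mat)"
  by (rule eq_matI) (auto simp: graph_matrix_index of_rat_mult of_rat_power)

section \<open>Diagonal dominance and the rank of the basis\<close>

lemma four_mult_le_power2: "4 * n \<le> (2 :: nat) ^ (n + 1)" if "0 < n"
proof -
  have "2 * Suc m \<le> (2 :: nat) ^ Suc m" for m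
    by (induction m) auto
  from this[of "n - 1"] that show ?thesis by simp
qed

text \<open>Cauchy-Schwarz against the all-ones vector: expand the square and use
  \<open>2 * f i * f j \<le> (f i)\<^sup>2 + (f j)\<^sup>2\<close> termwise.\<close>

lemma square_sum_le: "(\<Sum>i<n. f i)\<^sup>2 \<le> real n * (\<Sum>i<n. (f i)\<^sup>2)"
proof -
  have "(\<Sum>i<n. f i)\<^sup>2 = (\<Sum>i<n. \<Sum>j<n. f i * f j)"
    by (simp add: power2_eq_square sum_product)
  also have "\<dots> \<le> (\<Sum>i<n. \<Sum>j<n. ((f i)\<^sup>2 + (f j)\<^sup>2) / 2)"
    by (intro sum_mono) (use sum_squares_bound in \<open>simp add: field_simps\<close>)
  also have "\<dots> = real n * (\<Sum>i<n. (f i)\<^sup>2)"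
    by (simp add: add_divide_distrib sum.distrib sum_divide_distrib[symmetric] sum_distrib_left[symmetric])
  finally show ?thesis .
qed

text \<open>Each row is the diagonal term \<open>k * y l\<close> perturbed by a sum \<open>b\<close>
  with \<open>b\<^sup>2 \<le> n * s\<close>. Completing the square costs a quarter of the squared
  diagonal term and \<open>3 * b\<^sup>2\<close>. Over all rows the second loss is at most
  \<open>3 * n\<^sup>2 * s\<close>, hence at most \<open>3 / 16 * k\<^sup>2 * s\<close>, and
  \<open>3/4 - 3/16 = 9/16\<close>.\<close>

lemma diagonal_dominance_lower_bound:
  fixes k :: real and y :: "nat \<Rightarrow> real"
  assumes a: "\<And>l j. l < n \<Longrightarrow> j < n \<Longrightarrow> \<bar>a l j\<bar> \<le> 1" and k: "4 * real n \<le> k"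
  shows "9 / 16 * k\<^sup>2 * (\<Sum>l<n. (y l)\<^sup>2) \<le> (\<Sum>l<n. (k * y l + (\<Sum>j<n. a l j * y j))\<^sup>2)"
proof -
  define s where "s = (\<Sum>l<n. (y l)\<^sup>2)"
  have s: "0 \<le> s" by (simp add: s_def sum_nonneg)
  have "(real n)\<^sup>2 \<le> (k / 4)\<^sup>2"
    using k by (intro power_mono) auto
  then have n: "(real n)\<^sup>2 * s \<le> k\<^sup>2 / 16 * s"
    using s by (intro mult_right_mono) (simp_all add: power_divide)
  have "3 / 4 * k\<^sup>2 * (y l)\<^sup>2 - 3 * (real n * s) \<le> (k * y l + (\<Sum>j<n. a l j * y j))\<^sup>2" if "l < n" for l
  proof -
    define b where "b = (\<Sum>j<n. a l j * y j)"
    have "b\<^sup>2 \<le> real n * (\<Sum>j<n. (a l j * y j)\<^sup>2)"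
      unfolding b_def by (rule square_sum_le)
    also have "(\<Sum>j<n. (a l j * y j)\<^sup>2) \<le> s"
      unfolding s_def
    proof (intro sum_mono)
      fix j assume "j \<in> {..<n}"
      then have "(a l j)\<^sup>2 \<le> 1" using a that by (simp add: abs_square_le_1)
      then show "(a l j * y j)\<^sup>2 \<le> (y j)\<^sup>2"
        by (simp add: power_mult_distrib mult_left_le_one_le)
    qed
    finally have "b\<^sup>2 \<le> real n * s" by (simp add: mult_left_mono)
    moreover have "(k * y l + b)\<^sup>2 = 3 / 4 * k\<^sup>2 * (y l)\<^sup>2 - 3 * b\<^sup>2 + (k * y l / 2 + 2 * b)\<^sup>2"
      by (simp add: power2_eq_square algebra_simps)
    moreover have "0 \<le> (k * y l / 2 + 2 * b)\<^sup>2" by simp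
    ultimately show ?thesis unfolding b_def by linarith
  qed
  then have "(\<Sum>l<n. 3 / 4 * k\<^sup>2 * (y l)\<^sup>2 - 3 * (real n * s)) \<le>
      (\<Sum>l<n. (k * y l + (\<Sum>j<n. a l j * y j))\<^sup>2)"
    by (intro sum_mono) auto
  moreover have "(\<Sum>l<n. 3 / 4 * k\<^sup>2 * (y l)\<^sup>2 - 3 * (real n * s)) = 3 / 4 * k\<^sup>2 * s - 3 * ((real n)\<^sup>2 * s)"
    by (simp add: sum_subtractf sum_distrib_left s_def power2_eq_square mult_ac)
  ultimately show ?thesis using n unfolding s_def by linarith
qed

declare index_mult_mat_vec [simp del]

lemma mult_mat_vec_index:
  "i < dim_row A \<Longrightarrow> dim_vec v = dim_col A \<Longrightarrow> (A *\<^sub>v v) $ i = (\<Sum>j<dim_col A. A $$ (i, j) * v $ j)"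
  by (simp add: index_mult_mat_vec scalar_prod_def atLeast0LessThan)

lemma scalar_prod_self:
  fixes v :: "'a :: comm_semiring_1 vec"
  shows "v \<bullet> v = (\<Sum>i<dim_vec v. (v $ i)\<^sup>2)"
  by (simp add: scalar_prod_def atLeast0LessThan power2_eq_square)

lemma graph_matrix_norm_lower_bound:
  fixes v :: "real vec"
  assumes v: "v \<in> carrier_vec n" and n: "0 < n"
  shows "9 / 16 * (2 ^ (n + 1))\<^sup>2 * (v \<bullet> v) \<le> (graph_matrix n E *\<^sub>v v) \<bullet> (graph_matrix n E *\<^sub>v v)"
proof -
  define k :: real where "k = 2 ^ (n + 1)"
  \<comment> \<open>The off-diagonal part of the matrix. Singletons in \<open>E\<close> are masked
    by \<open>l \<noteq> j\<close>, just as \<open>graph_matrix\<close> ignores them.\<close>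
  define a :: "nat \<Rightarrow> nat \<Rightarrow> real" where "a l j = of_bool (l \<noteq> j \<and> {l, j} \<in> E)" for l j
  have "real (4 * n) \<le> real (2 ^ (n + 1))"
    using four_mult_le_power2[OF n] by (rule of_nat_mono)
  then have k: "4 * real n \<le> k" by (simp add: k_def)
  have entry: "(graph_matrix n E *\<^sub>v v) $ l = k * v $ l + (\<Sum>j<n. a l j * v $ j)" if "l < n" for l
  proof -
    have "(graph_matrix n E *\<^sub>v v) $ l = (\<Sum>j<n. (if j = l then k * v $ j else 0) + a l j * v $ j)"
      using that v unfolding mult_mat_vec_index[of l "graph_matrix n E" v, simplified, OF that carrier_vecD[OF v]]
      by (intro sum.cong) (auto simp: graph_matrix_index k_def a_def)
    also have "\<dots> = k * v $ l + (\<Sum>j<n. a l j * v $ j)"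
      using that by (simp add: sum.distrib)
    finally show ?thesis .
  qed
  have "9 / 16 * k\<^sup>2 * (\<Sum>l<n. (v $ l)\<^sup>2) \<le> (\<Sum>l<n. (k * v $ l + (\<Sum>j<n. a l j * v $ j))\<^sup>2)"
    using k by (intro diagonal_dominance_lower_bound) (simp_all add: a_def)
  also have "\<dots> = (graph_matrix n E *\<^sub>v v) \<bullet> (graph_matrix n E *\<^sub>v v)"
    by (simp add: scalar_prod_self entry)
  finally show ?thesis
    using v by (simp add: k_def scalar_prod_self)
qed

text \<open>The norm bound makes the kernel over the reals trivial. The nonzero real determinant is
  the image of the rational one, so the rational rank is full.\<close>

lemma rank_graph_matrix:
  assumes "0 < n"
  shows "vec_space.rank n (graph_matrix n E :: rat mat) = n"
proof -
  have "det (graph_matrix n E :: real mat) \<noteq> 0"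
  proof
    assume "det (graph_matrix n E :: real mat) = 0"
    then obtain v :: "real vec" where v: "v \<in> carrier_vec n" "v \<noteq> 0\<^sub>v n" "graph_matrix n E *\<^sub>v v = 0\<^sub>v n"
      using det_0_iff_vec_prod_zero_field[of "graph_matrix n E :: real mat" n] by auto
    have "9 / 16 * (2 ^ (n + 1))\<^sup>2 * (v \<bullet> v) \<le> 0"
      using graph_matrix_norm_lower_bound[OF v(1) assms, of E] v(3) by simp
    then have "v \<bullet> v \<le> 0"
      by (simp add: mult_le_0_iff)
    then have "(\<Sum>i<n. (v $ i)\<^sup>2) = 0"
      using v(1) sum_nonneg[of "{..<n}" "\<lambda>i. (v $ i)\<^sup>2"] by (simp add: scalar_prod_self)
    then have "\<forall>i<n. v $ i = 0"
      by (simp add: sum_nonneg_eq_0_iff)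
    with v(1,2) show False by (metis eq_vecI carrier_vecD index_zero_vec)
  qed
  then have "det (graph_matrix n E :: rat mat) \<noteq> 0"
    using of_rat_hom.hom_det[of "graph_matrix n E"] by (auto simp: of_rat_graph_matrix)
  then show ?thesis
    using vec_space.low_rank_det_zero[of "graph_matrix n E :: rat mat" n] by simp
qed

section \<open>From graph isomorphisms to lattice isometries\<close>

lemma graph_lattice:
  "lattice_with_basis (graph_matrix n E) =
     {graph_matrix n E *\<^sub>v map_vec of_int x | x. x \<in> carrier_vec n}"
  by (simp add: lattice_with_basis_def of_rat_graph_matrix)

text \<open>The permutation matrix \<open>U\<close> of \<open>\<sigma>\<close> satisfies
  \<open>U * ?G = ?H * U\<close>, because relabelling the vertices carries edges to edges and
  diagonal entries to diagonal entries. As \<open>U\<close> also permutes the integer vectors, it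
  maps the first lattice onto the second.\<close>

lemma isomorphic_graphs_imp_isomorphic_lattices:
  assumes "isomorphic_graphs n EG EH"
  shows "isomorphic_lattices n (graph_matrix n EG) (graph_matrix n EH)"
proof -
  obtain \<sigma> where \<sigma>: "\<sigma> permutes {..<n}"
    and E: "\<And>v w. v < n \<Longrightarrow> w < n \<Longrightarrow> {v, w} \<in> EG \<longleftrightarrow> {\<sigma> v, \<sigma> w} \<in> EH"
    using assms unfolding isomorphic_graphs_def by blast
  let ?G = "graph_matrix n EG :: real mat" and ?H = "graph_matrix n EH :: real mat"
  let ?\<tau> = "Hilbert_Choice.inv \<sigma>"
  have lt: "\<sigma> i < n \<longleftrightarrow> i < n" "?\<tau> i < n \<longleftrightarrow> i < n" for i
    using permutes_in_image[OF \<sigma>] permutes_in_image[OF permutes_inv[OF \<sigma>]] by auto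
  note inverses = permutes_inverses[OF \<sigma>]
  have eq: "i = \<sigma> j \<longleftrightarrow> j = ?\<tau> i" for i j
    using inverses by metis
  define U :: "real mat" where "U = mat n n (\<lambda>(i, j). if i = \<sigma> j then 1 else 0)"
  have U: "U \<in> carrier_mat n n" by (simp add: U_def)
  have Uv: "(U *\<^sub>v v) $ i = v $ ?\<tau> i" if "i < n" "v \<in> carrier_vec n" for v i
    using that lt by (simp add: mult_mat_vec_index U_def eq if_distrib[of "\<lambda>x. x * _"] cong: if_cong)
  have "transpose_mat U * U = 1\<^sub>m n"
  proof (rule eq_matI)
    fix i j assume ij: "i < dim_row (1\<^sub>m n :: real mat)" "j < dim_col (1\<^sub>m n :: real mat)"
    then have "(transpose_mat U * U) $$ (i, j) = (\<Sum>l<n. if l = \<sigma> i then (if l = \<sigma> j then 1 else 0) else 0)"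
      by (simp add: U_def scalar_prod_def atLeast0LessThan if_distrib[of "\<lambda>x. x * _"] cong: if_cong)
    also have "\<dots> = 1\<^sub>m n $$ (i, j)"
      using ij lt permutes_inj[OF \<sigma>] by (simp add: inj_eq)
    finally show "(transpose_mat U * U) $$ (i, j) = 1\<^sub>m n $$ (i, j)" .
  qed (simp_all add: U_def)
  then have orth: "orthogonal_transformation_mat n U"
    by (simp add: orthogonal_transformation_mat_def U)
  have entries: "?G $$ (?\<tau> i, j) = ?H $$ (i, \<sigma> j)" if "i < n" "j < n" for i j
    using that lt E[of "?\<tau> i" j] inverses by (auto simp: graph_matrix_index)
  have move: "U *\<^sub>v (?G *\<^sub>v map_vec of_int x) = ?H *\<^sub>v map_vec of_int (vec n (\<lambda>i. x $ ?\<tau> i))"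
    if "x \<in> carrier_vec n" for x
  proof (rule eq_vecI)
    fix i assume "i < dim_vec (?H *\<^sub>v map_vec of_int (vec n (\<lambda>i. x $ ?\<tau> i)))"
    then have i: "i < n" by simp
    have "(U *\<^sub>v (?G *\<^sub>v map_vec of_int x)) $ i = (\<Sum>j<n. ?G $$ (?\<tau> i, j) * of_int (x $ j))"
      using i lt that by (subst Uv) (simp_all add: mult_mat_vec_index mult_mat_vec_carrier[of _ n n])
    also have "\<dots> = (\<Sum>j<n. ?H $$ (i, \<sigma> j) * of_int (x $ ?\<tau> (\<sigma> j)))"
      using i entries inverses by simp
    also have "\<dots> = (\<Sum>j<n. ?H $$ (i, j) * of_int (x $ ?\<tau> j))"
      by (rule sum.permute[OF \<sigma>, symmetric, unfolded o_def])
    also have "\<dots> = (?H *\<^sub>v map_vec of_int (vec n (\<lambda>i. x $ ?\<tau> i))) $ i"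
      using i by (simp add: mult_mat_vec_index)
    finally show "(U *\<^sub>v (?G *\<^sub>v map_vec of_int x)) $ i = \<dots>" .
  qed (simp add: U_def)
  have "(\<lambda>v. U *\<^sub>v v) ` lattice_with_basis (graph_matrix n EG) = lattice_with_basis (graph_matrix n EH)"
  proof (intro equalityI subsetI)
    fix v assume "v \<in> (\<lambda>v. U *\<^sub>v v) ` lattice_with_basis (graph_matrix n EG)"
    then obtain x where "x \<in> carrier_vec n" "v = U *\<^sub>v (?G *\<^sub>v map_vec of_int x)"
      by (auto simp: graph_lattice)
    with move show "v \<in> lattice_with_basis (graph_matrix n EH)"
      unfolding graph_lattice by (intro CollectI exI[of _ "vec n (\<lambda>i. x $ ?\<tau> i)"]) simp
  next
    fix v assume "v \<in> lattice_with_basis (graph_matrix n EH)"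
    then obtain x where x: "x \<in> carrier_vec n" "v = ?H *\<^sub>v map_vec of_int x"
      by (auto simp: graph_lattice)
    \<comment> \<open>The preimage has as coordinates \<open>x\<close> composed with
      \<open>\<sigma>\<close>; permuting by \<open>?\<tau>\<close> gives back
      \<open>x\<close>.\<close>
    have "vec n (\<lambda>i. vec n (\<lambda>i. x $ \<sigma> i) $ ?\<tau> i) = x"
      using x(1) lt inverses by (intro eq_vecI) auto
    with move[of "vec n (\<lambda>i. x $ \<sigma> i)"] x(2)
    have "v = U *\<^sub>v (?G *\<^sub>v map_vec of_int (vec n (\<lambda>i. x $ \<sigma> i)))" by simp
    then show "v \<in> (\<lambda>v. U *\<^sub>v v) ` lattice_with_basis (graph_matrix n EG)"
      unfolding graph_lattice by (intro image_eqI[where x = "?G *\<^sub>v map_vec of_int (vec n (\<lambda>i. x $ \<sigma> i))"]) auto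
  qed
  with orth show ?thesis unfolding isomorphic_lattices_def by blast
qed

section \<open>Recovering the graph from Gram entries\<close>

definition gram :: "nat \<Rightarrow> nat set set \<Rightarrow> nat \<Rightarrow> nat \<Rightarrow> real" where
  "gram n E i j = col (graph_matrix n E) i \<bullet> col (graph_matrix n E) j"

text \<open>The terms \<open>l = i\<close> and \<open>l = j\<close> contribute the multiples of the
  scale. What remains is the number of common neighbours (the degree if \<open>i = j\<close>), which
  lies between 0 and \<open>n\<close>.\<close>

lemma gram_bounds:
  assumes "i < n" and "j < n"
  shows "i = j \<Longrightarrow> (2 ^ (n + 1))\<^sup>2 \<le> gram n E i j \<and> gram n E i j \<le> (2 ^ (n + 1))\<^sup>2 + real n"
    and "i \<noteq> j \<Longrightarrow> 2 * 2 ^ (n + 1) * of_bool ({i, j} \<in> E) \<le> gram n E i j \<and>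
      gram n E i j \<le> 2 * 2 ^ (n + 1) * of_bool ({i, j} \<in> E) + real n"
proof -
  let ?k = "2 ^ (n + 1) :: real"
  define a :: "nat \<Rightarrow> nat \<Rightarrow> real" where "a l j = of_bool (l \<noteq> j \<and> {l, j} \<in> E)" for l j
  have gram: "gram n E i j = (\<Sum>l<n. graph_matrix n E $$ (l, i) * graph_matrix n E $$ (l, j))"
    using assms by (simp add: gram_def scalar_prod_def atLeast0LessThan)
  have common: "0 \<le> (\<Sum>l<n. a l i * a l j)" "(\<Sum>l<n. a l i * a l j) \<le> real n"
    using sum_bounded_above[of "{..<n}" "\<lambda>l. a l i * a l j" 1]
    by (auto simp: a_def intro: sum_nonneg)
  {
    assume "i = j"
    then have "gram n E i j = (\<Sum>l<n. (if l = i then ?k\<^sup>2 else 0) + a l i * a l j)"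
      using assms unfolding gram
      by (intro sum.cong) (auto simp: graph_matrix_index a_def power2_eq_square)
    then have "gram n E i j = ?k\<^sup>2 + (\<Sum>l<n. a l i * a l j)"
      using assms by (simp add: sum.distrib)
    then show "?k\<^sup>2 \<le> gram n E i j \<and> gram n E i j \<le> ?k\<^sup>2 + real n"
      using common by simp
  }
  {
    assume ij: "i \<noteq> j"
    then have "gram n E i j = (\<Sum>l<n. (if l = i then ?k * of_bool ({i, j} \<in> E) else 0) +
        (if l = j then ?k * of_bool ({i, j} \<in> E) else 0) + a l i * a l j)"
      using assms unfolding gram
      by (intro sum.cong) (auto simp: graph_matrix_index a_def insert_commute)
    then have "gram n E i j = 2 * ?k * of_bool ({i, j} \<in> E) + (\<Sum>l<n. a l i * a l j)"
      using assms by (simp add: sum.distrib)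
    then show "2 * ?k * of_bool ({i, j} \<in> E) \<le> gram n E i j \<and>
        gram n E i j \<le> 2 * ?k * of_bool ({i, j} \<in> E) + real n"
      using common by simp
  }
qed

text \<open>A single nonzero integer coordinate already uses up the whole norm, so its square is 1
  and all others vanish.\<close>

lemma int_vec_norm_le_1:
  fixes x :: "int vec"
  assumes "x \<in> carrier_vec n" and "x \<noteq> 0\<^sub>v n" and "x \<bullet> x \<le> 1"
  obtains i s where "i < n" and "\<bar>s\<bar> = 1" and "x = s \<cdot>\<^sub>v unit_vec n i"
proof -
  obtain i where i: "i < n" "x $ i \<noteq> 0"
    using assms(1,2) by (metis eq_vecI carrier_vecD index_zero_vec)
  have sq: "x \<bullet> x = (x $ i)\<^sup>2 + (\<Sum>j\<in>{..<n} - {i}. (x $ j)\<^sup>2)"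
    using assms(1) i(1) sum.remove[of "{..<n}" i "\<lambda>j. (x $ j)\<^sup>2"] by (simp add: scalar_prod_self)
  have ge: "1 \<le> (x $ i)\<^sup>2" using i(2) by (simp add: int_one_le_iff_zero_less)
  have nonneg: "0 \<le> (\<Sum>j\<in>{..<n} - {i}. (x $ j)\<^sup>2)" by (simp add: sum_nonneg)
  have "(x $ i)\<^sup>2 = 1" and 0: "(\<Sum>j\<in>{..<n} - {i}. (x $ j)\<^sup>2) = 0"
    using sq ge nonneg assms(3) by linarith+
  then have "\<bar>x $ i\<bar> = 1" by (simp add: power2_eq_1_iff abs_if) auto
  moreover have "x = (x $ i) \<cdot>\<^sub>v unit_vec n i"
    using 0 assms(1) i(1) by (intro eq_vecI) (auto simp: sum_nonneg_eq_0_iff unit_vec_def)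
  ultimately show ?thesis using that i(1) by blast
qed

lemma mult_mat_vec_int_multiple:
  fixes A :: "real mat"
  assumes "A \<in> carrier_mat m n" and "p < n"
  shows "A *\<^sub>v map_vec of_int (s \<cdot>\<^sub>v unit_vec n p) = of_int s \<cdot>\<^sub>v col A p"
proof (rule eq_vecI)
  fix i assume "i < dim_vec (of_int s \<cdot>\<^sub>v col A p)"
  with assms have i: "i < m" by simp
  have "(A *\<^sub>v map_vec of_int (s \<cdot>\<^sub>v unit_vec n p)) $ i =
      (\<Sum>j<n. A $$ (i, j) * of_int (s * unit_vec n p $ j))"
    using assms i by (subst mult_mat_vec_index) simp_all
  also have "\<dots> = (\<Sum>j<n. if j = p then of_int s * A $$ (i, p) else 0)"
    using assms(2) by (intro sum.cong) auto
  also have "\<dots> = (of_int s \<cdot>\<^sub>v col A p) $ i"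
    using assms i by simp
  finally show "(A *\<^sub>v map_vec of_int (s \<cdot>\<^sub>v unit_vec n p)) $ i = (of_int s \<cdot>\<^sub>v col A p) $ i" .
qed (use assms in simp)

lemma orthogonal_scalar_prod:
  assumes "orthogonal_transformation_mat n U" and "u \<in> carrier_vec n" and "v \<in> carrier_vec n"
  shows "(U *\<^sub>v u) \<bullet> (U *\<^sub>v v) = u \<bullet> v"
proof -
  have U: "U \<in> carrier_mat n n" "transpose_mat U * U = 1\<^sub>m n"
    using assms(1) by (auto simp: orthogonal_transformation_mat_def)
  have "(U *\<^sub>v u) \<bullet> (U *\<^sub>v v) = (transpose_mat U *\<^sub>v (U *\<^sub>v u)) \<bullet> v"
    using transpose_vec_mult_scalar[OF U(1) assms(3), of "U *\<^sub>v u"] U assms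
    by (simp add: mult_mat_vec_carrier[of _ n n])
  also have "transpose_mat U *\<^sub>v (U *\<^sub>v u) = u"
    using U assms by (subst assoc_mult_mat_vec[symmetric, of _ n n _ n]) auto
  finally show ?thesis .
qed

lemma isomorphic_lattices_imp_isomorphic_graphs:
  assumes n: "0 < n"
    and iso: "isomorphic_lattices n (graph_matrix n EG) (graph_matrix n EH)"
    and simple: "simple_graph n EG" "simple_graph n EH"
  shows "isomorphic_graphs n EG EH"
proof -
  let ?G = "graph_matrix n EG :: real mat" and ?H = "graph_matrix n EH :: real mat"
  define k :: real where "k = 2 ^ (n + 1)"
  have "real (4 * n) \<le> real (2 ^ (n + 1))"
    using four_mult_le_power2[OF n] by (rule of_nat_mono)
  then have k: "4 * real n \<le> k" by (simp add: k_def)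
  have n1: "1 \<le> real n" using n by simp
  have "0 < k" by (simp add: k_def)
  have "4 * k \<le> k * k" using k n1 by (intro mult_right_mono) auto
  \<comment> \<open>Separates Gram entries on the diagonal, at least \<open>k\<^sup>2\<close>, from
    those off the diagonal, at most \<open>2 * k + n\<close>.\<close>
  then have k2: "2 * k + real n < k\<^sup>2" using k n1 unfolding power2_eq_square by linarith
  obtain U where U: "orthogonal_transformation_mat n U" and
    img: "(\<lambda>v. U *\<^sub>v v) ` lattice_with_basis (graph_matrix n EG) = lattice_with_basis (graph_matrix n EH)"
    using iso unfolding isomorphic_lattices_def by blast
  \<comment> \<open>The integer coordinates \<open>x\<close> of the image with respect to
    \<open>?H\<close> turn out to be nonzero with \<open>x \<bullet> x \<le> 1\<close>, so only one
    of them is nonzero, and it is 1 or -1.\<close>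
  have "\<exists>p s. p < n \<and> \<bar>s\<bar> = 1 \<and> U *\<^sub>v col ?G i = s \<cdot>\<^sub>v col ?H p" if i: "i < n" for i
  proof -
    have "col ?G i = ?G *\<^sub>v map_vec of_int (1 \<cdot>\<^sub>v unit_vec n i)"
      using mult_mat_vec_int_multiple[of ?G n n i 1] i by simp
    moreover have "1 \<cdot>\<^sub>v unit_vec n i \<in> carrier_vec n" by simp
    ultimately have "col ?G i \<in> lattice_with_basis (graph_matrix n EG)"
      unfolding graph_lattice by blast
    then have "U *\<^sub>v col ?G i \<in> lattice_with_basis (graph_matrix n EH)"
      using img by blast
    then obtain x where x: "x \<in> carrier_vec n" "U *\<^sub>v col ?G i = ?H *\<^sub>v map_vec of_int x"
      by (auto simp: graph_lattice)
    let ?x = "map_vec real_of_int x"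
    have norm: "(?H *\<^sub>v ?x) \<bullet> (?H *\<^sub>v ?x) = gram n EG i i"
      using orthogonal_scalar_prod[OF U, of "col ?G i" "col ?G i"] i x(2) by (simp add: gram_def)
    have "9 / 16 * k\<^sup>2 * (?x \<bullet> ?x) \<le> k\<^sup>2 + real n"
      using graph_matrix_norm_lower_bound[of ?x n EH] gram_bounds(1)[OF i i refl, of EG] norm x(1) n
      by (simp add: k_def)
    moreover have "?x \<bullet> ?x = of_int (x \<bullet> x)"
      by (simp add: scalar_prod_self)
    ultimately have bound: "9 / 16 * k\<^sup>2 * of_int (x \<bullet> x) \<le> k\<^sup>2 + real n" by simp
    have "x \<bullet> x \<le> 1"
    \<comment> \<open>From \<open>x \<bullet> x \<ge> 2\<close> one gets
      \<open>9 / 8 * k\<^sup>2 \<le> k\<^sup>2 + n\<close>, hence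
      \<open>k\<^sup>2 \<le> 8 * n\<close>, against \<open>k\<^sup>2 \<ge> 16 * n\<close>.\<close>
    proof (rule ccontr)
      assume "\<not> x \<bullet> x \<le> 1"
      then have "2 \<le> real_of_int (x \<bullet> x)" by linarith
      then have "9 / 16 * k\<^sup>2 * 2 \<le> 9 / 16 * k\<^sup>2 * of_int (x \<bullet> x)"
        by (intro mult_left_mono) auto
      with bound have "k\<^sup>2 \<le> 8 * real n" by linarith
      moreover have "4 * real n * 4 \<le> k * k"
        using k n1 by (intro mult_mono) auto
      ultimately show False using n1 by (simp add: power2_eq_square)
    qed
    moreover have "x \<noteq> 0\<^sub>v n"
    proof
      assume "x = 0\<^sub>v n"
      then have "gram n EG i i = 0"
        using norm by (simp add: scalar_prod_self mult_mat_vec_index)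
      with gram_bounds(1)[OF i i refl, of EG] show False
        by (simp add: not_less[symmetric] zero_less_power)
    qed
    ultimately obtain p s where ps: "p < n" "\<bar>s\<bar> = 1" "x = s \<cdot>\<^sub>v unit_vec n p"
      using int_vec_norm_le_1[OF x(1)] by metis
    have "?H *\<^sub>v ?x = of_int s \<cdot>\<^sub>v col ?H p"
      using mult_mat_vec_int_multiple[of ?H n n p s] ps by simp
    moreover have "\<bar>real_of_int s\<bar> = 1" using ps(2) by linarith
    ultimately show ?thesis using x(2) ps(1) by auto
  qed
  then obtain p s where p: "\<And>i. i < n \<Longrightarrow> p i < n" and s: "\<And>i. i < n \<Longrightarrow> \<bar>s i :: real\<bar> = 1"
    and Up: "\<And>i. i < n \<Longrightarrow> U *\<^sub>v col ?G i = s i \<cdot>\<^sub>v col ?H (p i)"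
    by metis
  \<comment> \<open>Absolute values absorb the unknown signs \<open>s i\<close>. Since all Gram
    entries are nonnegative, the entries themselves then agree.\<close>
  have gram: "\<bar>gram n EG i j\<bar> = \<bar>gram n EH (p i) (p j)\<bar>" if "i < n" "j < n" for i j
  proof -
    have "gram n EG i j = (U *\<^sub>v col ?G i) \<bullet> (U *\<^sub>v col ?G j)"
      using that by (subst orthogonal_scalar_prod[OF U]) (simp_all add: gram_def)
    also have "\<dots> = s i * s j * gram n EH (p i) (p j)"
      using that p by (simp add: Up gram_def)
    finally show ?thesis using s that by (simp add: abs_mult)
  qed
  have nonneg: "0 \<le> gram n E i j" if "i < n" "j < n" for E i j
    using gram_bounds[OF that, of E]
    by (cases "i = j") (auto intro: order_trans[rotated])
  have gram_eq: "gram n EG i j = gram n EH (p i) (p j)" if "i < n" "j < n" for i j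
    using gram[OF that] nonneg that p by simp
  \<comment> \<open>If two columns had the same image up to sign, an off-diagonal Gram entry for
    \<open>EG\<close> would equal a diagonal one for \<open>EH\<close>, contradicting
    \<open>k2\<close>.\<close>
  have inj: "p i \<noteq> p j" if "i < n" "j < n" "i \<noteq> j" for i j
  proof
    assume eq: "p i = p j"
    have "k\<^sup>2 \<le> gram n EH (p i) (p j)"
      using gram_bounds(1)[OF p p eq, of EH] that by (simp add: k_def)
    moreover have "gram n EG i j \<le> 2 * k * of_bool ({i, j} \<in> EG) + real n"
      using gram_bounds(2)[OF that, of EG] by (simp add: k_def)
    moreover have "2 * k * of_bool ({i, j} \<in> EG) \<le> 2 * k"
      using k n1 by simp
    ultimately show False using gram_eq[OF that(1,2)] k2 by linarith
  qed
  \<comment> \<open>Non-edges have Gram entries in \<open>[0, n]\<close> and edges in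
    \<open>[2 * k, 2 * k + n]\<close>; these ranges are disjoint because
    \<open>n < 2 * k\<close>.\<close>
  have edges: "{i, j} \<in> EG \<longleftrightarrow> {p i, p j} \<in> EH" if "i < n" "j < n" "i \<noteq> j" for i j
    using gram_bounds(2)[OF that, of EG, folded k_def]
      gram_bounds(2)[OF p p inj[OF that], of EH, folded k_def] that
      gram_eq[OF that(1,2)] k \<open>0 < k\<close>
    by (cases "{i, j} \<in> EG"; cases "{p i, p j} \<in> EH") simp_all
  \<comment> \<open>The isomorphism condition also ranges over \<open>v = w\<close>, where
    \<open>{v, w}\<close> is a singleton and so not an edge of a simple graph.\<close>
  have no_loop: "{i, i} \<notin> EG" "{i, i} \<notin> EH" for i
    using simple by (auto simp: simple_graph_def)
  \<comment> \<open>\<open>permutes\<close> demands the identity outside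
    \<open>{..<n}\<close>.\<close>
  define \<sigma> where "\<sigma> i = (if i < n then p i else i)" for i
  have "\<sigma> permutes {..<n}"
    using p inj by (intro inj_imp_permutes) (auto simp: \<sigma>_def inj_on_def)
  moreover have "\<forall>v<n. \<forall>w<n. {v, w} \<in> EG \<longleftrightarrow> {\<sigma> v, \<sigma> w} \<in> EH"
    using edges no_loop by (metis \<sigma>_def)
  ultimately show ?thesis unfolding isomorphic_graphs_def by blast
qed

section \<open>Running time of Turing machines\<close>

text \<open>Only an upper bound on the number of steps is recorded, so phases with data-dependent
  length compose by adding bounds.\<close>

definition reaches :: "turing_machine \<Rightarrow> config \<Rightarrow> nat \<Rightarrow> config \<Rightarrow> bool" where
  "reaches M c b c' \<longleftrightarrow> (\<exists>t \<le> b. (tm_step M ^^ t) c = c')"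

lemma reaches_refl: "reaches M c b c"
  unfolding reaches_def by (rule exI[of _ 0]) simp

lemma reaches_trans:
  assumes "reaches M c a c'" and "reaches M c' b c''"
  shows "reaches M c (a + b) c''"
proof -
  obtain s t where "s \<le> a" "(tm_step M ^^ s) c = c'" "t \<le> b" "(tm_step M ^^ t) c' = c''"
    using assms unfolding reaches_def by blast
  then have "(tm_step M ^^ (t + s)) c = c''"
    by (simp add: funpow_add)
  with \<open>s \<le> a\<close> \<open>t \<le> b\<close> show ?thesis
    unfolding reaches_def by (intro exI[of _ "t + s"]) simp
qed

lemma reaches_mono: "reaches M c a c' \<Longrightarrow> a \<le> b \<Longrightarrow> reaches M c b c'"
  unfolding reaches_def using le_trans by blast

lemma reaches_step:
  assumes "tm_step M c = c'" and "reaches M c' b c''"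
  shows "reaches M c (Suc b) c''"
proof -
  have "reaches M c 1 c'"
    unfolding reaches_def using assms(1) by (intro exI[of _ 1]) simp
  from reaches_trans[OF this assms(2)] show ?thesis by simp
qed

section \<open>Reading and extending words on a tape\<close>

lemma symbol_code_pos: "0 < symbol_code s"
  by (cases s) auto

lemma word_contents_append: "word_contents (xs @ s # ys) (int (length xs)) = symbol_code s"
  by (simp add: word_contents_def)

lemma word_contents_blank [simp]:
  "word_contents xs (int (length xs)) = 0" "word_contents xs (-1) = 0"
  by (simp_all add: word_contents_def)

lemma word_contents_nonblank: "k < length xs \<Longrightarrow> 0 < word_contents xs (int k)"
  by (simp add: word_contents_def symbol_code_pos)

lemma word_contents_extend:
  "(word_contents xs)(int (length xs) := symbol_code s) = word_contents (xs @ [s])"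
  by (auto simp: word_contents_def fun_eq_iff nth_append)

lemma word_contents_replicate:
  "word_contents (replicate n s) i = (if 0 \<le> i \<and> i < int n then symbol_code s else 0)"
  by (auto simp: word_contents_def)

section \<open>Binary counters\<close>

text \<open>The least significant bit is in cell 0 and the number grows to the left, so that reading
  the tape from left to right yields \<open>encode_nat\<close>.\<close>

definition counter_contents :: "symbol list \<Rightarrow> int \<Rightarrow> nat" where
  "counter_contents xs i = word_contents xs (- i)"

lemma counter_contents_append:
  "counter_contents (xs @ s # ys) (- int (length xs)) = symbol_code s"
  by (simp add: counter_contents_def word_contents_append)

lemma counter_contents_blank [simp]:
  "counter_contents xs (- int (length xs)) = 0" "counter_contents xs 1 = 0"
  by (simp_all add: counter_contents_def)

lemma counter_contents_nonblank: "k < length xs \<Longrightarrow> 0 < counter_contents xs (- int k)"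
  by (simp add: counter_contents_def word_contents_nonblank)

lemma counter_contents_update:
  "(counter_contents (xs @ s # ys))(- int (length xs) := symbol_code r) =
    counter_contents (xs @ r # ys)"
  by (auto simp: counter_contents_def word_contents_def fun_eq_iff nth_append nth_Cons'
      split: if_splits)

lemma counter_contents_extend:
  "(counter_contents xs)(- int (length xs) := symbol_code s) = counter_contents (xs @ [s])"
  by (auto simp: counter_contents_def word_contents_def fun_eq_iff nth_append)

text \<open>Bits come least significant first, and the empty list stands for zero, so a blank tape
  is a counter with value zero.\<close>

fun increment :: "symbol list \<Rightarrow> symbol list" where
  "increment [] = [One]"
| "increment (x # xs) = (if x = One then Zero # increment xs else One # xs)"

lemma length_increment: "length (increment xs) \<le> Suc (length xs)"
  by (induction xs) auto

lemma length_increment_iter: "length ((increment ^^ n) xs) \<le> n + length xs"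
  by (induction n) (auto intro: le_trans[OF length_increment])

lemma set_increment: "set xs \<subseteq> {Zero, One} \<Longrightarrow> set (increment xs) \<subseteq> {Zero, One}"
  by (induction xs) auto

text \<open>By halving: for odd \<open>k\<close> the carry passes to the digits of
  \<open>k div 2\<close>, and for even \<open>k\<close> the halves of \<open>k\<close> and
  \<open>Suc k\<close> coincide.\<close>

lemma increment_encode_nat:
  "0 < k \<Longrightarrow> increment (rev (encode_nat k)) = rev (encode_nat (Suc k))"
proof (induction k rule: less_induct)
  case (less k)
  show ?case
  proof (cases "k < 2")
    case True
    with less.prems have "k = 1" by simp
    then show ?thesis by (simp add: encode_nat.simps[of "Suc 0"] encode_nat.simps[of "Suc (Suc 0)"])
  next
    case False
    then have k: "rev (encode_nat k) = (if odd k then One else Zero) # rev (encode_nat (k div 2))"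
      by (simp add: encode_nat.simps[of k])
    from False have Sk: "rev (encode_nat (Suc k)) =
        (if even k then One else Zero) # rev (encode_nat (Suc k div 2))"
      by (simp add: encode_nat.simps[of "Suc k"])
    show ?thesis
      using less.IH[of "k div 2"] False k Sk by auto
  qed
qed

text \<open>Starts at one, because \<open>encode_nat 0\<close> is the digit \<open>Zero\<close>
  whereas the untouched counter is empty.\<close>

lemma increment_iter_encode_nat: "(increment ^^ Suc n) [] = rev (encode_nat (Suc n))"
proof (induction n)
  case 0
  show ?case by (simp add: encode_nat.simps[of "Suc 0"])
next
  case (Suc n)
  then show ?case using increment_encode_nat[of "Suc n"] by simp
qed

text \<open>This shape lets the machine write a diagonal entry by copying the zeros of tape
  2.\<close>

lemma encode_nat_power2: "encode_nat (2 ^ k) = One # replicate k Zero"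
proof (induction k)
  case 0
  show ?case by (simp add: encode_nat.simps)
next
  case (Suc k)
  then show ?case using encode_nat.simps[of "2 ^ Suc k"] by (simp add: replicate_append_same)
qed

section \<open>The machine computing the reduction\<close>

text \<open>The output for a graph without vertices, which is treated as a graph with one vertex.\<close>

definition one_vertex_output :: "symbol list" where
  "one_vertex_output = [One, Semicolon, One, Semicolon, One, Zero, Zero, Slash, One, Comma,
     Semicolon, One, Zero, Zero, Slash, One, Comma]"

text \<open>
  Tape 2 holds \<open>n + 1\<close> zeros, tape 3 a binary counter.
  \<^item> 0--2 read the first row of the first matrix, for each entry writing a zero on tape 2 and
    incrementing the counter (1 propagates the carry, 2 returns to cell 0).
  \<^item> 3--6 write the counter to the output twice; 7 and 8 rewind tapes 0 and 2.
  \<^item> 9 reads an input symbol. In the input, which contains a comma after each row, the diagonal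
    entries are exactly \<open>n + 2\<close> symbols apart. So the head of tape 2 can detect them: it moves left
    by one cell per symbol and is on the blank to the left of the zeros at a diagonal entry.
  \<^item> 10 writes the zeros of \<open>2 ^ (n + 1)\<close>, which takes tape 2 back to its right end.
  \<^item> 11--13 complete an entry by the denominator 1 and a comma.
  \<^item> 14--30 write \<^term>\<open>one_vertex_output\<close>; 31 is the halting state.
\<close>

definition reduction_trans :: "nat \<Rightarrow> nat list \<Rightarrow> nat \<times> (nat \<times> move) list" where
  "reduction_trans q xs = (let a = xs ! 0; b = xs ! 1; c = xs ! 2; d = xs ! 3 in
     if q = 0 then
       (if a = symbol_code Semicolon then (14, [(a, Stay), (b, Stay), (c, Stay), (d, Stay)])
        else if a = symbol_code Comma then
          (3, [(a, Stay), (b, Stay), (symbol_code Zero, Stay), (d, Stay)])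
        else (1, [(a, MoveR), (b, Stay), (symbol_code Zero, MoveR), (d, Stay)]))
     else if q = 1 then
       (if d = symbol_code One then
          (1, [(a, Stay), (b, Stay), (c, Stay), (symbol_code Zero, MoveL)])
        else (2, [(a, Stay), (b, Stay), (c, Stay), (symbol_code One, Stay)]))
     else if q = 2 then
       (if d = 0 then (0, [(a, Stay), (b, Stay), (c, Stay), (d, MoveL)])
        else (2, [(a, Stay), (b, Stay), (c, Stay), (d, MoveR)]))
     else if q = 3 \<or> q = 5 then
       (if d = 0 then (q + 1, [(a, Stay), (b, Stay), (c, Stay), (d, MoveR)])
        else (q, [(a, Stay), (b, Stay), (c, Stay), (d, MoveL)]))
     else if q = 4 \<or> q = 6 then
       (if d = 0 then (q + 1, [(a, Stay), (symbol_code Semicolon, MoveR), (c, Stay), (d, MoveL)])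
        else (q, [(a, Stay), (d, MoveR), (c, Stay), (d, MoveR)]))
     else if q = 7 then
       (if a = 0 then (8, [(a, MoveR), (b, Stay), (c, Stay), (d, Stay)])
        else (7, [(a, MoveL), (b, Stay), (c, Stay), (d, Stay)]))
     else if q = 8 then
       (if c = 0 then (9, [(a, Stay), (b, Stay), (c, Stay), (d, Stay)])
        else (8, [(a, Stay), (b, Stay), (c, MoveL), (d, Stay)]))
     else if q = 9 then
       (if a = 0 then (31, [(a, Stay), (b, Stay), (c, Stay), (d, Stay)])
        else if a = symbol_code Semicolon then
          (8, [(a, MoveR), (symbol_code Semicolon, MoveR), (c, Stay), (d, Stay)])
        else if a = symbol_code Comma then
          (9, [(a, MoveR), (b, Stay), (c, if c = 0 then Stay else MoveL), (d, Stay)])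
        else if c = 0 then
          (10, [(a, MoveR), (symbol_code One, MoveR), (c, MoveR), (d, Stay)])
        else (11, [(a, MoveR), (a, MoveR), (c, MoveL), (d, Stay)]))
     else if q = 10 then
       (if c = 0 then (11, [(a, Stay), (b, Stay), (c, MoveL), (d, Stay)])
        else (10, [(a, Stay), (symbol_code Zero, MoveR), (c, MoveR), (d, Stay)]))
     else if q = 11 then (12, [(a, Stay), (symbol_code Slash, MoveR), (c, Stay), (d, Stay)])
     else if q = 12 then (13, [(a, Stay), (symbol_code One, MoveR), (c, Stay), (d, Stay)])
     else if q = 13 then (9, [(a, Stay), (symbol_code Comma, MoveR), (c, Stay), (d, Stay)])
     else (q + 1, [(a, Stay), (symbol_code (one_vertex_output ! (q - 14)), MoveR),
       (c, Stay), (d, Stay)]))"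

definition reduction_machine :: turing_machine where
  "reduction_machine =
     \<lparr>num_tapes = 4, num_symbols = 7, num_states = 31, trans = reduction_trans\<rparr>"

lemma reduction_machine_sel [simp]:
  "num_tapes reduction_machine = 4" "num_symbols reduction_machine = 7"
  "num_states reduction_machine = 31" "trans reduction_machine = reduction_trans"
  by (simp_all add: reduction_machine_def)

lemma wf_reduction_machine: "wf_turing_machine reduction_machine"
proof -
  have code: "symbol_code s < 7" for s
    by (cases s) auto
  have "case reduction_trans q xs of (q', as) \<Rightarrow>
      q' \<le> 31 \<and> length as = 4 \<and> fst ` set as \<subseteq> {..<7}"
    if q: "q < 31" and xs: "length xs = 4" "set xs \<subseteq> {..<7}" for q xs
  proof -
    have "xs ! i < 7" if "i < 4" for i
      using xs(2) nth_mem[of i xs] that xs(1) by (auto simp del: nth_mem)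
    then have "xs ! 0 < 7" "xs ! 1 < 7" "xs ! 2 < 7" "xs ! 3 < 7"
      by simp_all
    then show ?thesis
      using q code by (auto simp: reduction_trans_def Let_def simp del: symbol_code.simps)
  qed
  then show ?thesis
    by (simp add: wf_turing_machine_def code)
qed

text \<open>The output head always stands on the first blank after the output, so appending a symbol
  is a single step.\<close>

abbreviation conf :: "nat \<Rightarrow> symbol list \<Rightarrow> int \<Rightarrow> symbol list \<Rightarrow>
    (int \<Rightarrow> nat) \<Rightarrow> int \<Rightarrow> (int \<Rightarrow> nat) \<Rightarrow> int \<Rightarrow> config" where
  "conf q inp i out c2 h2 c3 h3 \<equiv>
     (q, [(word_contents inp, i), (word_contents out, int (length out)), (c2, h2), (c3, h3)])"

section \<open>The phases of a run\<close>

declare fun_upd_idem [simp]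

text \<open>For the induction, \<open>ys\<close> holds the low-order bits that the carry has passed.
  The cell \<open>k\<close> in which the carry stops depends on the bits, hence the
  existential.\<close>

lemma increment_loop:
  assumes "set bs \<subseteq> {Zero, One}"
  shows "\<exists>k < length (ys @ increment bs).
    reaches reduction_machine
      (conf 1 inp i out c2 h2 (counter_contents (ys @ bs)) (- int (length ys)))
      (length bs + 1)
      (conf 2 inp i out c2 h2 (counter_contents (ys @ increment bs)) (- int k))"
  using assms
proof (induction bs arbitrary: ys)
  case Nil
  have "reaches reduction_machine
      (conf 1 inp i out c2 h2 (counter_contents ys) (- int (length ys))) (Suc 0)
      (conf 2 inp i out c2 h2 (counter_contents (ys @ [One])) (- int (length ys)))"
    by (rule reaches_step[OF _ reaches_refl])
      (use counter_contents_extend[of ys One] in \<open>simp add: reduction_trans_def\<close>)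
  then show ?case by (intro exI[of _ "length ys"]) simp
next
  case (Cons b bs)
  show ?case
  proof (cases "b = One")
    case True
    obtain k where k: "k < length ((ys @ [Zero]) @ increment bs)"
      "reaches reduction_machine
        (conf 1 inp i out c2 h2 (counter_contents ((ys @ [Zero]) @ bs)) (- int (length (ys @ [Zero]))))
        (length bs + 1)
        (conf 2 inp i out c2 h2 (counter_contents ((ys @ [Zero]) @ increment bs)) (- int k))"
      using Cons.IH[of "ys @ [Zero]"] Cons.prems by auto
    have "tm_step reduction_machine
        (conf 1 inp i out c2 h2 (counter_contents (ys @ b # bs)) (- int (length ys))) =
        conf 1 inp i out c2 h2 (counter_contents ((ys @ [Zero]) @ bs)) (- int (length (ys @ [Zero])))"
      using True counter_contents_update[of ys One bs Zero]
      by (simp add: reduction_trans_def counter_contents_append)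
    from reaches_step[OF this k(2)] k(1) True show ?thesis
      by (intro exI[of _ k]) simp
  next
    case False
    with Cons.prems have b: "b = Zero" by auto
    have "reaches reduction_machine
        (conf 1 inp i out c2 h2 (counter_contents (ys @ b # bs)) (- int (length ys)))
        (Suc (length bs + 1))
        (conf 2 inp i out c2 h2 (counter_contents (ys @ One # bs)) (- int (length ys)))"
      by (rule reaches_step[OF _ reaches_refl])
        (use b counter_contents_update[of ys Zero bs One] in
          \<open>simp add: reduction_trans_def counter_contents_append\<close>)
    then show ?thesis using False by (intro exI[of _ "length ys"]) simp
  qed
qed

text \<open>The head recognises cell 0 by overshooting to the blank in cell 1 and stepping back,
  which accounts for the 2 in the bound.\<close>

lemma return_loop:
  assumes "k < length bs"
  shows "reaches reduction_machine
    (conf 2 inp i out c2 h2 (counter_contents bs) (- int k)) (k + 2)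
    (conf 0 inp i out c2 h2 (counter_contents bs) 0)"
  using assms
proof (induction k)
  case 0
  show ?case
    using counter_contents_nonblank[of 0 bs] 0
    by (auto intro!: reaches_step[OF refl] reaches_refl simp: reduction_trans_def numeral_2_eq_2)
next
  case (Suc k)
  have "tm_step reduction_machine
      (conf 2 inp i out c2 h2 (counter_contents bs) (- int (Suc k))) =
      conf 2 inp i out c2 h2 (counter_contents bs) (- int k)"
    using counter_contents_nonblank[of "Suc k" bs] Suc.prems by (simp add: reduction_trans_def)
  from reaches_step[OF this] Suc show ?case by simp
qed

text \<open>An increment adds at most one bit, so \<open>length bs + length xs\<close> bounds the
  counter length throughout, and each symbol costs at most a carry run and a return run.\<close>

lemma count_loop:
  assumes "set xs \<subseteq> {Zero, One}" and "set bs \<subseteq> {Zero, One}"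
  shows "reaches reduction_machine
    (conf 0 (pre @ xs @ post) (int (length pre)) out
      (word_contents (replicate j Zero)) (int j) (counter_contents bs) 0)
    (length xs * (2 * (length bs + length xs) + 5))
    (conf 0 (pre @ xs @ post) (int (length (pre @ xs))) out
      (word_contents (replicate (j + length xs) Zero)) (int (j + length xs))
      (counter_contents ((increment ^^ length xs) bs)) 0)"
  using assms
proof (induction xs arbitrary: pre j bs)
  case Nil
  show ?case by (simp add: reaches_refl)
next
  case (Cons x xs)
  let ?inp = "pre @ (x # xs) @ post" and ?i = "int (length (pre @ [x]))"
  let ?z = "word_contents (replicate (Suc j) Zero)"
  have x: "x = Zero \<or> x = One" using Cons.prems by auto
  have s1: "tm_step reduction_machine
     (conf 0 ?inp (int (length pre)) out
      (word_contents (replicate j Zero)) (int j) (counter_contents bs) 0) =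
     conf 1 ?inp ?i out ?z (int (Suc j)) (counter_contents bs) 0"
    using x word_contents_append[of pre x "xs @ post"] word_contents_extend[of "replicate j Zero" Zero]
    by (auto simp: reduction_trans_def replicate_append_same)
  obtain k where k: "k < length (increment bs)" and s2: "reaches reduction_machine
      (conf 1 ?inp ?i out ?z (int (Suc j)) (counter_contents bs) 0) (length bs + 1)
      (conf 2 ?inp ?i out ?z (int (Suc j)) (counter_contents (increment bs)) (- int k))"
    using increment_loop[OF Cons.prems(2), of "[]" ?inp ?i out ?z "int (Suc j)"] by auto
  have s3: "reaches reduction_machine
      (conf 0 ((pre @ [x]) @ xs @ post) ?i out ?z (int (Suc j)) (counter_contents (increment bs)) 0)
      (length xs * (2 * (length (increment bs) + length xs) + 5))
      (conf 0 ((pre @ [x]) @ xs @ post) (int (length ((pre @ [x]) @ xs))) out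
        (word_contents (replicate (Suc j + length xs) Zero)) (int (Suc j + length xs))
        (counter_contents ((increment ^^ length xs) (increment bs))) 0)"
    using Cons.prems by (intro Cons.IH set_increment) auto
  \<comment> \<open>The cost allowed per symbol. It also bounds the cost in the induction
    hypothesis, where the counter may be one bit longer but the word is one symbol shorter.\<close>
  define y where "y = 2 * (length bs + length (x # xs)) + 5"
  have "length xs * (2 * (length (increment bs) + length xs) + 5) \<le> length xs * y"
    using length_increment[of bs] unfolding y_def by (intro mult_le_mono2) simp
  moreover have "length (x # xs) * y = y + length xs * y" by simp
  moreover have "y = 2 * length bs + 2 * length xs + 7" by (simp add: y_def)
  moreover have "k \<le> length bs" using k length_increment[of bs] by simp
  ultimately have bound: "Suc ((length bs + 1) + ((k + 2) +
      length xs * (2 * (length (increment bs) + length xs) + 5))) \<le> length (x # xs) * y"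
    by linarith
  have out: "reaches reduction_machine
     (conf 0 ?inp (int (length pre)) out
      (word_contents (replicate j Zero)) (int j) (counter_contents bs) 0)
     (Suc ((length bs + 1) + ((k + 2) + length xs * (2 * (length (increment bs) + length xs) + 5))))
     (conf 0 ((pre @ [x]) @ xs @ post) (int (length ((pre @ [x]) @ xs))) out
        (word_contents (replicate (Suc j + length xs) Zero)) (int (Suc j + length xs))
        (counter_contents ((increment ^^ length xs) (increment bs))) 0)"
    using s3 by (intro reaches_step[OF s1] reaches_trans[OF s2] reaches_trans[OF return_loop[OF k]]) simp
  have "(increment ^^ length xs) (increment bs) = (increment ^^ length (x # xs)) bs"
    by (simp add: funpow_swap1)
  with reaches_mono[OF out bound] show ?case by (simp add: y_def)
qed

text \<open>Here \<open>k\<close> is the distance to the blank beyond the most significant bit; on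
  that blank the head turns and ends one cell to its right.\<close>

lemma counter_to_left_end:
  assumes "q = 3 \<or> q = 5" and "k \<le> length bs"
  shows "reaches reduction_machine
    (conf q inp i out c2 h2 (counter_contents bs) (int k - int (length bs))) (k + 1)
    (conf (q + 1) inp i out c2 h2 (counter_contents bs) (1 - int (length bs)))"
  using assms(2)
proof (induction k)
  case 0
  show ?case
    using assms(1) by (auto intro!: reaches_step[OF _ reaches_refl] simp: reduction_trans_def)
next
  case (Suc k)
  have "int (Suc k) - int (length bs) = - int (length bs - Suc k)"
    using Suc.prems by simp
  then have "tm_step reduction_machine
      (conf q inp i out c2 h2 (counter_contents bs) (int (Suc k) - int (length bs))) =
      conf q inp i out c2 h2 (counter_contents bs) (int k - int (length bs))"
    using counter_contents_nonblank[of "length bs - Suc k" bs] Suc.prems assms(1)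
    by (cases "bs = []") (auto simp: reduction_trans_def Let_def)
  from reaches_step[OF this] Suc show ?case by simp
qed

text \<open>The digits \<open>ds\<close> are less relevant to the run than their place: they lie to
  the left and are already copied, while \<open>bs\<close> is still to be copied from its most
  significant end. The blank in cell 1 triggers the semicolon and the step back to cell 0.\<close>

lemma copy_counter:
  assumes "q = 4 \<or> q = 6"
  shows "reaches reduction_machine
    (conf q inp i out c2 h2 (counter_contents (bs @ ds)) (1 - int (length bs))) (length bs + 1)
    (conf (q + 1) inp i (out @ rev bs @ [Semicolon]) c2 h2 (counter_contents (bs @ ds)) 0)"
proof (induction bs arbitrary: ds out rule: rev_induct)
  case Nil
  show ?case
    using assms word_contents_extend[of out Semicolon]
    by (auto intro!: reaches_step[OF _ reaches_refl] simp: reduction_trans_def)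
next
  case (snoc b bs)
  have "tm_step reduction_machine
      (conf q inp i out c2 h2 (counter_contents ((bs @ [b]) @ ds)) (1 - int (length (bs @ [b])))) =
      conf q inp i (out @ [b]) c2 h2 (counter_contents (bs @ b # ds)) (1 - int (length bs))"
    using assms counter_contents_append[of bs b ds] symbol_code_pos[of b]
      word_contents_extend[of out b]
    by (auto simp: reduction_trans_def Let_def)
  from reaches_step[OF this snoc.IH] show ?case by simp
qed

lemma output_counter:
  assumes "q = 3 \<or> q = 5"
  shows "reaches reduction_machine
    (conf q inp i out c2 h2 (counter_contents bs) 0) (2 * length bs + 2)
    (conf (q + 2) inp i (out @ rev bs @ [Semicolon]) c2 h2 (counter_contents bs) 0)"
proof -
  have q: "q + 1 = 4 \<or> q + 1 = 6" using assms by auto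
  have "reaches reduction_machine
    (conf q inp i out c2 h2 (counter_contents bs) (int (length bs) - int (length bs)))
      ((length bs + 1) + (length bs + 1))
    (conf (q + 1 + 1) inp i (out @ rev bs @ [Semicolon]) c2 h2 (counter_contents (bs @ [])) 0)"
    using copy_counter[OF q, of inp i out c2 h2 bs "[]"]
    by (intro reaches_trans[OF counter_to_left_end[OF assms order_refl]]) simp
  then show ?thesis by (simp add: mult_2)
qed

lemma rewind_input:
  assumes "k \<le> length inp"
  shows "reaches reduction_machine
    (conf 7 inp (int k - 1) out c2 h2 c3 h3) (k + 1) (conf 8 inp 0 out c2 h2 c3 h3)"
  using assms
proof (induction k)
  case 0
  show ?case
    by (auto intro!: reaches_step[OF _ reaches_refl] simp: reduction_trans_def)
next
  case (Suc k)
  have "tm_step reduction_machine (conf 7 inp (int (Suc k) - 1) out c2 h2 c3 h3) =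
      conf 7 inp (int k - 1) out c2 h2 c3 h3"
    using word_contents_nonblank[of k inp] Suc.prems by (simp add: reduction_trans_def)
  from reaches_step[OF this] Suc show ?case by simp
qed

text \<open>Unlike the input head, this head stays on the blank in cell -1, the mark of a diagonal
  entry, since a matrix begins with one.\<close>

lemma rewind_zeros:
  assumes "k \<le> L"
  shows "reaches reduction_machine
    (conf 8 inp i out (word_contents (replicate L Zero)) (int k - 1) c3 h3) (k + 1)
    (conf 9 inp i out (word_contents (replicate L Zero)) (-1) c3 h3)"
  using assms
proof (induction k)
  case 0
  show ?case
    by (auto intro!: reaches_step[OF _ reaches_refl] simp: reduction_trans_def)
next
  case (Suc k)
  have "tm_step reduction_machine
        (conf 8 inp i out (word_contents (replicate L Zero)) (int (Suc k) - 1) c3 h3) =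
      conf 8 inp i out (word_contents (replicate L Zero)) (int k - 1) c3 h3"
    using word_contents_nonblank[of k "replicate L Zero"] Suc.prems
    by (simp add: reduction_trans_def)
  from reaches_step[OF this] Suc show ?case by simp
qed

text \<open>Here \<open>k\<close> counts the zeros still to be copied. Ending on the last zero
  restarts the countdown to the next diagonal entry.\<close>

lemma emit_zeros:
  assumes "k \<le> L"
  shows "reaches reduction_machine
    (conf 10 inp i out (word_contents (replicate L Zero)) (int L - int k) c3 h3) (k + 1)
    (conf 11 inp i (out @ replicate k Zero) (word_contents (replicate L Zero)) (int L - 1) c3 h3)"
  using assms
proof (induction k arbitrary: out)
  case 0
  show ?case
    by (auto intro!: reaches_step[OF _ reaches_refl]
        simp: reduction_trans_def word_contents_replicate)
next
  case (Suc k)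
  have "tm_step reduction_machine
        (conf 10 inp i out (word_contents (replicate L Zero)) (int L - int (Suc k)) c3 h3) =
      conf 10 inp i (out @ [Zero]) (word_contents (replicate L Zero)) (int L - int k) c3 h3"
    using word_contents_nonblank[of "L - Suc k" "replicate L Zero"] Suc.prems
      word_contents_extend[of out Zero]
    by (simp add: reduction_trans_def of_nat_diff algebra_simps)
  from reaches_step[OF this Suc.IH] Suc.prems show ?case by simp
qed

lemma finish_entry:
  "reaches reduction_machine (conf 11 inp i out c2 h2 c3 h3) 3
    (conf 9 inp i (out @ [Slash, One, Comma]) c2 h2 c3 h3)"
proof -
  have 1: "tm_step reduction_machine (conf 11 inp i out c2 h2 c3 h3) =
      conf 12 inp i (out @ [Slash]) c2 h2 c3 h3"
    using word_contents_extend[of out Slash] by (simp add: reduction_trans_def)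
  have 2: "tm_step reduction_machine (conf 12 inp i (out @ [Slash]) c2 h2 c3 h3) =
      conf 13 inp i (out @ [Slash, One]) c2 h2 c3 h3"
    using word_contents_extend[of "out @ [Slash]" One] by (simp add: reduction_trans_def)
  have 3: "tm_step reduction_machine (conf 13 inp i (out @ [Slash, One]) c2 h2 c3 h3) =
      conf 9 inp i (out @ [Slash, One, Comma]) c2 h2 c3 h3"
    using word_contents_extend[of "out @ [Slash, One]" Comma] by (simp add: reduction_trans_def)
  from reaches_step[OF 1 reaches_step[OF 2 reaches_step[OF 3 reaches_refl[where b = 0]]]]
  show ?thesis by (simp add: numeral_3_eq_3)
qed

text \<open>The output produced in states 9 to 13, where \<open>c\<close> is the head position on tape 2, shifted by 1.\<close>

fun scan :: "nat \<Rightarrow> nat \<Rightarrow> symbol list \<Rightarrow> symbol list" where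
  "scan L c [] = []"
| "scan L c (x # xs) =
     (if x = Comma then scan L (c - 1) xs
      else if c = 0 then One # replicate L Zero @ [Slash, One, Comma] @ scan L L xs
      else x # [Slash, One, Comma] @ scan L (c - 1) xs)"

text \<open>The most expensive symbol is a diagonal entry: one step to write \<open>One\<close>,
  \<open>L + 1\<close> for the zeros and 3 to finish. Of the final position \<open>c'\<close> only
  the bound matters, since tape 2 is rewound before the next matrix.\<close>

lemma scan_loop:
  assumes "set xs \<subseteq> {Zero, One, Comma}" and "c \<le> L"
  shows "\<exists>c' \<le> L. reaches reduction_machine
    (conf 9 (pre @ xs @ post) (int (length pre)) out
      (word_contents (replicate L Zero)) (int c - 1) c3 h3)
    (length xs * (L + 5))
    (conf 9 (pre @ xs @ post) (int (length (pre @ xs))) (out @ scan L c xs)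
      (word_contents (replicate L Zero)) (int c' - 1) c3 h3)"
  using assms
proof (induction xs arbitrary: pre c out)
  case Nil
  then show ?case by (intro exI[of _ c]) (simp add: reaches_refl)
next
  case (Cons x xs)
  let ?inp = "pre @ (x # xs) @ post" and ?i = "int (length (pre @ [x]))"
  let ?z = "word_contents (replicate L Zero)"
  have rd: "word_contents ?inp (int (length pre)) = symbol_code x"
    using word_contents_append[of pre x "xs @ post"] by simp
  have x: "x = Zero \<or> x = One \<or> x = Comma" using Cons.prems by auto
  define out' where "out' = (if x = Comma then out
      else if c = 0 then out @ One # replicate L Zero @ [Slash, One, Comma]
      else out @ x # [Slash, One, Comma])"
  \<comment> \<open>For a comma at \<open>c = 0\<close>, truncated subtraction keeps
    \<open>d = 0\<close>, matching the machine, which stays on the blank in that case.\<close>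
  define d where "d = (if x \<noteq> Comma \<and> c = 0 then L else c - 1)"
  have "d \<le> L" using Cons.prems by (auto simp: d_def)
  have first: "reaches reduction_machine (conf 9 ?inp (int (length pre)) out ?z (int c - 1) c3 h3)
      (L + 5) (conf 9 ?inp ?i out' ?z (int d - 1) c3 h3)"
  proof (cases "x = Comma")
    case True
    have "tm_step reduction_machine (conf 9 ?inp (int (length pre)) out ?z (int c - 1) c3 h3) =
        conf 9 ?inp ?i out' ?z (int d - 1) c3 h3"
      using rd True Cons.prems by (auto simp: reduction_trans_def d_def out'_def word_contents_replicate)
    from reaches_mono[OF reaches_step[OF this reaches_refl[where b = 0]]] show ?thesis by simp
  next
    case False
    with x have x': "x = Zero \<or> x = One" by simp
    show ?thesis
    proof (cases "c = 0")
      case True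
      have 1: "tm_step reduction_machine (conf 9 ?inp (int (length pre)) out ?z (int c - 1) c3 h3) =
          conf 10 ?inp ?i (out @ [One]) ?z (int L - int L) c3 h3"
        using rd x' True word_contents_extend[of out One] by (auto simp: reduction_trans_def)
      have "reaches reduction_machine (conf 9 ?inp (int (length pre)) out ?z (int c - 1) c3 h3)
          (Suc ((L + 1) + 3))
          (conf 9 ?inp ?i (((out @ [One]) @ replicate L Zero) @ [Slash, One, Comma]) ?z (int L - 1) c3 h3)"
        by (intro reaches_step[OF 1] reaches_trans[OF emit_zeros] finish_entry) simp
      then show ?thesis using False True by (simp add: out'_def d_def eval_nat_numeral)
    next
      case c: False
      have 1: "tm_step reduction_machine (conf 9 ?inp (int (length pre)) out ?z (int c - 1) c3 h3) =
          conf 11 ?inp ?i (out @ [x]) ?z (int d - 1) c3 h3"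
        using rd x' c Cons.prems word_contents_extend[of out x]
        by (auto simp: reduction_trans_def d_def word_contents_replicate)
      have "reaches reduction_machine (conf 9 ?inp (int (length pre)) out ?z (int c - 1) c3 h3)
          (Suc 3) (conf 9 ?inp ?i ((out @ [x]) @ [Slash, One, Comma]) ?z (int d - 1) c3 h3)"
        by (intro reaches_step[OF 1] finish_entry)
      from reaches_mono[OF this] show ?thesis using False c by (simp add: out'_def)
    qed
  qed
  obtain c' where c': "c' \<le> L" "reaches reduction_machine
    (conf 9 ((pre @ [x]) @ xs @ post) ?i out' ?z (int d - 1) c3 h3)
    (length xs * (L + 5))
    (conf 9 ((pre @ [x]) @ xs @ post) (int (length ((pre @ [x]) @ xs))) (out' @ scan L d xs)
      ?z (int c' - 1) c3 h3)"
    using Cons.IH[of d "pre @ [x]" out'] Cons.prems \<open>d \<le> L\<close> by auto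
  have "out' @ scan L d xs = out @ scan L c (x # xs)"
    by (simp add: out'_def d_def)
  moreover have "reaches reduction_machine
      (conf 9 ?inp (int (length pre)) out ?z (int c - 1) c3 h3) ((L + 5) + length xs * (L + 5))
      (conf 9 ((pre @ [x]) @ xs @ post) (int (length ((pre @ [x]) @ xs))) (out' @ scan L d xs)
      ?z (int c' - 1) c3 h3)"
    using c'(2) by (intro reaches_trans[OF first]) simp
  ultimately show ?case using c'(1) by (intro exI[of _ c']) simp
qed

section \<open>Complete runs\<close>

lemma machine_constant_output:
  "reaches reduction_machine (conf 0 (Semicolon # post) 0 [] c2 h2 c3 h3) 18
    (conf 31 (Semicolon # post) 0 one_vertex_output c2 h2 c3 h3)"
proof -
  let ?inp = "Semicolon # post"
  have "reaches reduction_machine (conf 14 ?inp 0 [] c2 h2 c3 h3) j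
      (conf (14 + j) ?inp 0 (take j one_vertex_output) c2 h2 c3 h3)" if "j \<le> 17" for j
    using that
  proof (induction j)
    case 0
    show ?case by (simp add: reaches_refl)
  next
    case (Suc j)
    have len: "j < length one_vertex_output"
      using Suc.prems by (simp add: one_vertex_output_def)
    then have take: "length (take j one_vertex_output) = j" by simp
    have "tm_step reduction_machine (conf (14 + j) ?inp 0 (take j one_vertex_output) c2 h2 c3 h3) =
        conf (14 + Suc j) ?inp 0 (take (Suc j) one_vertex_output) c2 h2 c3 h3"
      using word_contents_extend[of "take j one_vertex_output" "one_vertex_output ! j"]
        Suc.prems take len
      by (simp add: reduction_trans_def take_Suc_conv_app_nth)
    from reaches_trans[OF Suc.IH reaches_step[OF this reaches_refl[where b = 0]]] Suc.prems
    show ?case by simp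
  qed
  from this[of 17] have "reaches reduction_machine (conf 14 ?inp 0 [] c2 h2 c3 h3) 17
      (conf 31 ?inp 0 one_vertex_output c2 h2 c3 h3)"
    by (simp add: one_vertex_output_def)
  \<comment> \<open>A semicolon in the very first cell signals a graph without vertices.\<close>
  moreover have "tm_step reduction_machine (conf 0 ?inp 0 [] c2 h2 c3 h3) =
      conf 14 ?inp 0 [] c2 h2 c3 h3"
    by (simp add: reduction_trans_def word_contents_def)
  ultimately show ?thesis
    using reaches_step by fastforce
qed

text \<open>Chains the phases: count the first row, write the dimension twice, rewind, scan the
  first matrix, rewind tape 2, scan the second. Only the first row must be singled out, since it
  alone determines the dimension.\<close>

lemma machine_output:
  fixes row :: "symbol list"
  assumes row: "set row \<subseteq> {Zero, One}" "row \<noteq> []"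
    and G: "xs = row @ Comma # rest" "set rest \<subseteq> {Zero, One, Comma}"
    and H: "set ys \<subseteq> {Zero, One, Comma}"
    and inp: "inp = xs @ Semicolon # ys"
    and L: "L = Suc (length row)"
    and num: "num = encode_nat (length row)"
  shows "\<exists>h2 c3 h3. reaches reduction_machine
    (conf 0 inp 0 [] (word_contents []) 0 (counter_contents []) 0)
    (50 * (length inp + 1) ^ 2)
    (conf 31 inp (int (length inp))
      (num @ [Semicolon] @ num @ [Semicolon] @ scan L 0 xs @ [Semicolon] @ scan L 0 ys)
      (word_contents (replicate L Zero)) h2 c3 h3)"
proof -
  let ?n = "length row" and ?l = "length inp"
  define b where "b = (increment ^^ ?n) []"
  have b: "rev b = num"
    using row increment_iter_encode_nat[of "?n - 1"] by (simp add: b_def num)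
  have lb: "length b \<le> ?n"
    using length_increment_iter[of ?n "[]"] by (simp add: b_def)
  let ?c = "counter_contents b" and ?z = "word_contents (replicate L Zero)"
  have n: "?n < ?l" by (simp add: inp G)
  have 1: "reaches reduction_machine
      (conf 0 inp 0 [] (word_contents []) 0 (counter_contents []) 0) (?n * (2 * ?n + 5))
      (conf 0 inp (int ?n) [] (word_contents (replicate ?n Zero)) (int ?n) ?c 0)"
    using count_loop[of row "[]" "[]" "Comma # rest @ Semicolon # ys" "[]" 0] row
    by (auto simp: inp G b_def)
  have rd: "word_contents inp (int ?n) = symbol_code Comma"
    using word_contents_append[of row Comma] by (simp add: inp G)
  \<comment> \<open>The comma after the first row contributes the last of the \<open>L\<close> zeros
    on tape 2, one more than the length of the row.\<close>
  have 2: "tm_step reduction_machine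
      (conf 0 inp (int ?n) [] (word_contents (replicate ?n Zero)) (int ?n) ?c 0) =
      conf 3 inp (int ?n) [] ?z (int ?n) ?c 0"
    using rd word_contents_extend[of "replicate ?n Zero" Zero]
    by (simp add: reduction_trans_def L replicate_append_same)
  have "reaches reduction_machine (conf 3 inp (int ?n) [] ?z (int ?n) ?c 0) (2 * length b + 2)
      (conf 5 inp (int ?n) (num @ [Semicolon]) ?z (int ?n) ?c 0)"
    using output_counter[of 3 inp "int ?n" "[]" ?z "int ?n" b] by (simp add: b)
  moreover have "reaches reduction_machine
      (conf 5 inp (int ?n) (num @ [Semicolon]) ?z (int ?n) ?c 0) (2 * length b + 2)
      (conf 7 inp (int (Suc ?n) - 1) (num @ [Semicolon] @ num @ [Semicolon]) ?z (int (Suc ?n) - 1) ?c 0)"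
    using output_counter[of 5 inp "int ?n" "num @ [Semicolon]" ?z "int ?n" b] by (simp add: b)
  ultimately have 3: "reaches reduction_machine (conf 3 inp (int ?n) [] ?z (int ?n) ?c 0)
      ((2 * length b + 2) + (2 * length b + 2))
      (conf 7 inp (int (Suc ?n) - 1) (num @ [Semicolon] @ num @ [Semicolon]) ?z (int (Suc ?n) - 1) ?c 0)"
    by (rule reaches_trans)
  define out where "out = num @ [Semicolon] @ num @ [Semicolon]"
  have 4: "reaches reduction_machine
      (conf 7 inp (int (Suc ?n) - 1) out ?z (int (Suc ?n) - 1) ?c 0)
      ((Suc ?n + 1) + (Suc ?n + 1)) (conf 9 inp 0 out ?z (-1) ?c 0)"
    using n by (intro reaches_trans[OF rewind_input] rewind_zeros) (auto simp: L)
  have xs: "set xs \<subseteq> {Zero, One, Comma}" using row G by auto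
  obtain c where c: "c \<le> L" and 5: "reaches reduction_machine
      (conf 9 inp 0 out ?z (-1) ?c 0) (length xs * (L + 5))
      (conf 9 inp (int (length xs)) (out @ scan L 0 xs) ?z (int c - 1) ?c 0)"
    using scan_loop[OF xs, of 0 L "[]" "Semicolon # ys" out ?c 0] by (auto simp: inp)
  let ?out1 = "out @ scan L 0 xs @ [Semicolon]"
  have 6: "tm_step reduction_machine
      (conf 9 inp (int (length xs)) (out @ scan L 0 xs) ?z (int c - 1) ?c 0) =
      conf 8 inp (int (length (xs @ [Semicolon]))) ?out1 ?z (int c - 1) ?c 0"
    using word_contents_append[of xs Semicolon ys] word_contents_extend[of "out @ scan L 0 xs" Semicolon]
    by (simp add: reduction_trans_def inp)
  obtain d where 7: "reaches reduction_machine
      (conf 9 inp (int (length (xs @ [Semicolon]))) ?out1 ?z (-1) ?c 0)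
      (length ys * (L + 5))
      (conf 9 inp (int ?l) (?out1 @ scan L 0 ys) ?z (int d - 1) ?c 0)"
    using scan_loop[OF H, of 0 L "xs @ [Semicolon]" "[]" ?out1 ?c 0] by (auto simp: inp)
  have 8: "tm_step reduction_machine
      (conf 9 inp (int ?l) (?out1 @ scan L 0 ys) ?z (int d - 1) ?c 0) =
      conf 31 inp (int ?l) (?out1 @ scan L 0 ys) ?z (int d - 1) ?c 0"
    by (simp add: reduction_trans_def)
  let ?t = "?n * (2 * ?n + 5) + Suc ((2 * length b + 2 + (2 * length b + 2)) +
      ((Suc ?n + 1 + (Suc ?n + 1)) + (length xs * (L + 5) +
      Suc ((c + 1) + (length ys * (L + 5) + Suc 0)))))"
  have run: "reaches reduction_machine
      (conf 0 inp 0 [] (word_contents []) 0 (counter_contents []) 0) ?t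
      (conf 31 inp (int ?l) (?out1 @ scan L 0 ys) ?z (int d - 1) ?c 0)"
    by (intro reaches_trans[OF 1] reaches_step[OF 2] reaches_trans[OF 3[folded out_def]]
        reaches_trans[OF 4] reaches_trans[OF 5] reaches_step[OF 6]
        reaches_trans[OF rewind_zeros[OF c]] reaches_trans[OF 7] reaches_step[OF 8] reaches_refl)
  \<comment> \<open>All lengths involved are at most \<open>m\<close>. Naming the square
    \<open>w\<close> makes the final estimate linear, with \<open>m \<le> w\<close> absorbing the
    lower-order terms; 50 is a generous constant.\<close>
  define m where "m = ?l + 1"
  have le: "?n \<le> m" "L \<le> m" "length b \<le> m" "c \<le> m" "length xs + length ys \<le> m" "1 \<le> m"
    using n lb c by (auto simp: m_def L inp)
  define w where "w = m * m"
  have "?n * (2 * ?n + 5) \<le> m * (2 * m + 5)"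
    using le by (intro mult_le_mono) auto
  also have "\<dots> = 2 * w + 5 * m" by (simp add: w_def algebra_simps)
  finally have count: "?n * (2 * ?n + 5) \<le> 2 * w + 5 * m" .
  have "length xs * (L + 5) + length ys * (L + 5) = (length xs + length ys) * (L + 5)"
    by (simp only: distrib_right)
  also have "\<dots> \<le> m * (m + 5)"
    using le by (intro mult_le_mono) auto
  also have "\<dots> = w + 5 * m" by (simp add: w_def algebra_simps)
  finally have scans: "length xs * (L + 5) + length ys * (L + 5) \<le> w + 5 * m" .
  have "m \<le> w" by (simp add: w_def)
  then have "?t \<le> 50 * w"
    using count scans le by linarith
  then have "?t \<le> 50 * m ^ 2" by (simp add: w_def power2_eq_square)
  from reaches_mono[OF run this] show ?thesis
    unfolding m_def out_def by (intro exI) simp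
qed

section \<open>Correctness of the reduction\<close>

lemma encode_rat_of_int: "encode_rat (of_int z) = encode_int z @ [Slash, One]"
  by (simp add: encode_rat_def encode_int_def encode_nat.simps)

lemma encode_rat_simps:
  "encode_rat 0 = [Zero, Slash, One]" "encode_rat 1 = [One, Slash, One]"
  "encode_rat (2 ^ k) = One # replicate k Zero @ [Slash, One]"
proof -
  show "encode_rat 0 = [Zero, Slash, One]" "encode_rat 1 = [One, Slash, One]"
    using encode_rat_of_int[of 0] encode_rat_of_int[of 1]
    by (simp_all add: encode_int_def encode_nat.simps)
  show "encode_rat (2 ^ k) = One # replicate k Zero @ [Slash, One]"
    using encode_rat_of_int[of "2 ^ k"]
    by (simp add: encode_int_def nat_power_eq encode_nat_power2)
qed

text \<open>The countdown starts no lower than the length of \<open>xs\<close>, so it cannot reach a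
  diagonal entry within \<open>xs\<close>.\<close>

lemma scan_off_diagonal:
  assumes "set xs \<subseteq> {Zero, One}"
  shows "scan L (length xs + c) (xs @ ys) =
    concat (map (\<lambda>x. [x, Slash, One, Comma]) xs) @ scan L c ys"
  using assms by (induction xs) auto

text \<open>Starting at \<open>i\<close>, the countdown reaches 0 exactly in column \<open>i\<close>
  and is reset to \<open>n + 1\<close>. The remaining \<open>n - 1 - i\<close> entries and the comma
  leave \<open>i + 1\<close>, the right start for the next row.\<close>

lemma scan_row:
  assumes "i < n"
  shows "scan (n + 1) i (map (\<lambda>j. if {i, j} \<in> E then One else Zero) [0..<n] @ Comma # rest) =
    concat (map (\<lambda>j. encode_rat (graph_matrix n E $$ (i, j)) @ [Comma]) [0..<n]) @
      scan (n + 1) (Suc i) rest"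
proof -
  define f where "f j = (if {i, j} \<in> E then One else Zero)" for j
  define e where "e j = encode_rat (graph_matrix n E $$ (i, j)) @ [Comma]" for j
  have upt: "[0..<n] = [0..<i] @ i # [Suc i..<n]"
    using assms upt_add_eq_append[of 0 i "n - i"] by (simp add: upt_conv_Cons)
  have off: "concat (map (\<lambda>x. [x, Slash, One, Comma]) (map f js)) = concat (map e js)"
    if "\<forall>j \<in> set js. j < n \<and> j \<noteq> i" for js
    using that assms
    by (induction js) (auto simp: e_def f_def graph_matrix_index encode_rat_simps)
  have bits: "set (map f js) \<subseteq> {Zero, One}" for js
    by (auto simp: f_def)
  have fi: "f i \<noteq> Comma" by (simp add: f_def)
  have "scan (n + 1) i (map f [0..<n] @ Comma # rest) =
      concat (map e [0..<i]) @ scan (n + 1) 0 (f i # map f [Suc i..<n] @ Comma # rest)"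
    using scan_off_diagonal[OF bits, of "n + 1" "[0..<i]" 0] off[of "[0..<i]"] assms
    by (simp add: upt)
  also have "scan (n + 1) 0 (f i # map f [Suc i..<n] @ Comma # rest) =
      e i @ scan (n + 1) (n + 1) (map f [Suc i..<n] @ Comma # rest)"
    using fi assms encode_rat_simps(3)[of "n + 1"] by (simp add: e_def graph_matrix_index)
  also have "scan (n + 1) (n + 1) (map f [Suc i..<n] @ Comma # rest) =
      concat (map e [Suc i..<n]) @ scan (n + 1) (Suc i) rest"
    using scan_off_diagonal[OF bits, of "n + 1" "[Suc i..<n]" "i + 2" "Comma # rest"]
      off[of "[Suc i..<n]"] assms by simp
  finally show ?thesis
    by (simp add: upt f_def[symmetric] e_def[symmetric])
qed

text \<open>Row \<open>m\<close> begins with the countdown at \<open>m\<close>, so the rows chain,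
  beginning from 0.\<close>

lemma scan_encode_graph:
  "scan (n + 1) 0 (encode_graph n E) = encode_mat (graph_matrix n E)"
proof -
  define row where "row = (\<lambda>i. map (\<lambda>j. if {i, j} \<in> E then One else Zero) [0..<n] @ [Comma])"
  define enc where
    "enc i = concat (map (\<lambda>j. encode_rat (graph_matrix n E $$ (i, j)) @ [Comma]) [0..<n])" for i
  have "scan (n + 1) 0 (concat (map row [0..<m]) @ rest) =
      concat (map enc [0..<m]) @ scan (n + 1) m rest" if "m \<le> n" for m rest
    using that
  proof (induction m arbitrary: rest)
    case (Suc m)
    then show ?case
      using scan_row[of m n E rest] by (simp add: row_def enc_def)
  qed simp
  from this[of n "[]"] have "scan (n + 1) 0 (encode_graph n E) = concat (map enc [0..<n])"
    by (simp add: encode_graph_def row_def)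
  moreover have "concat (map enc ks) =
      concat (map (\<lambda>r. encode_rat r @ [Comma])
        (concat (map (\<lambda>i. map (\<lambda>j. graph_matrix n E $$ (i, j)) [0..<n]) ks)))" for ks
    by (induction ks) (simp_all add: enc_def comp_def)
  then have "concat (map enc [0..<n]) = encode_mat (graph_matrix n E)"
    by (simp add: encode_mat_def mat_to_list_def)
  ultimately show ?thesis by simp
qed

lemma set_encode_graph: "set (encode_graph n E) \<subseteq> {Zero, One, Comma}"
  by (auto simp: encode_graph_def)

text \<open>Lattice instances need positive dimension, so the graph without vertices is replaced by
  one isolated vertex.\<close>

definition reduction :: "nat \<times> nat set set \<times> nat set set \<Rightarrow> nat \<times> nat \<times> rat mat \<times> rat mat" where
  "reduction = (\<lambda>(n, EG, EH). let m = max 1 n in (m, m, graph_matrix m EG, graph_matrix m EH))"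

lemma reduction_computable:
  "polynomial_time_computable graph_isomorphism lattice_isomorphism reduction"
proof -
  define p :: "nat poly" where "p = [:50:] * [:1, 1:] ^ 2"
  have p: "poly p x = 50 * (x + 1)\<^sup>2" for x
    by (simp add: p_def)
  have "tm_computes_within reduction_machine (encoding graph_isomorphism (n, EG, EH))
      (encoding lattice_isomorphism (reduction (n, EG, EH)))
      (poly p (length (encoding graph_isomorphism (n, EG, EH))))"
    if G: "simple_graph n EG" and H: "simple_graph n EH" for n EG EH
  proof -
    define inp where "inp = encoding graph_isomorphism (n, EG, EH)"
    define out where "out = encoding lattice_isomorphism (reduction (n, EG, EH))"
    have inp: "inp = encode_graph n EG @ Semicolon # encode_graph n EH"
      by (simp add: inp_def graph_isomorphism_def)
    have init: "tm_init reduction_machine inp =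
        conf 0 inp 0 [] (word_contents []) 0 (counter_contents []) 0"
      by (simp add: tm_init_def numeral_3_eq_3 counter_contents_def fun_eq_iff word_contents_def)
    have "\<exists>i c2 h2 c3 h3. reaches reduction_machine (tm_init reduction_machine inp)
        (50 * (length inp + 1)\<^sup>2) (conf 31 inp i out c2 h2 c3 h3)"
    proof (cases "n = 0")
      case True
      then have "EG = {}" "EH = {}"
        using G H by (auto simp: simple_graph_def)
      \<comment> \<open>With one vertex the diagonal entry is \<open>2 ^ 2\<close>, which is
        hard-coded in \<open>one_vertex_output\<close>.\<close>
      have four: "encode_rat 4 = [One, Zero, Zero, Slash, One]"
        using encode_rat_simps(3)[of 2] by (simp add: numeral_2_eq_2)
      have "out = one_vertex_output"
        using True by (simp add: out_def lattice_isomorphism_def reduction_def one_vertex_output_def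
            encode_mat_def mat_to_list_def graph_matrix_index encode_nat.simps four)
      moreover have "inp = [Semicolon]"
        using True by (simp add: inp encode_graph_def)
      moreover have "reaches reduction_machine
          (conf 0 [Semicolon] 0 [] (word_contents []) 0 (counter_contents []) 0)
          (50 * (length [Semicolon] + 1)\<^sup>2)
          (conf 31 [Semicolon] 0 one_vertex_output (word_contents []) 0 (counter_contents []) 0)"
        by (rule reaches_mono[OF machine_constant_output]) (simp add: power2_eq_square)
      ultimately show ?thesis
        unfolding init by blast
    next
      case False
      \<comment> \<open>The encoding is split after its first row, the part read by the counting
        phase.\<close>
      define row where "row = map (\<lambda>w. if {0, w} \<in> EG then One else Zero) [0..<n]"
      define rest where "rest = concat (map
        (\<lambda>v. map (\<lambda>w. if {v, w} \<in> EG then One else Zero) [0..<n] @ [Comma]) [1..<n])"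
      have "encode_graph n EG = row @ Comma # rest"
        using False by (simp add: encode_graph_def row_def rest_def upt_conv_Cons)
      moreover have "set row \<subseteq> {Zero, One}" "row \<noteq> []" "length row = n"
          "set rest \<subseteq> {Zero, One, Comma}"
        using False by (auto simp: row_def rest_def)
      ultimately have "\<exists>h2 c3 h3. reaches reduction_machine (tm_init reduction_machine inp)
          (50 * (length inp + 1)\<^sup>2)
          (conf 31 inp (int (length inp)) (encode_nat n @ [Semicolon] @ encode_nat n @ [Semicolon] @
            scan (n + 1) 0 (encode_graph n EG) @ [Semicolon] @ scan (n + 1) 0 (encode_graph n EH))
            (word_contents (replicate (n + 1) Zero)) h2 c3 h3)"
        unfolding init
        by (intro machine_output[where row = row and rest = rest] set_encode_graph inp) simp_all
      moreover have "max 1 n = n" using False by simp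
      ultimately show ?thesis
        by (simp add: scan_encode_graph[simplified] out_def lattice_isomorphism_def reduction_def Let_def) blast
    qed
    then show ?thesis
      unfolding tm_computes_within_def reaches_def inp_def[symmetric] out_def[symmetric] p
      by fastforce
  qed
  then show ?thesis
    unfolding polynomial_time_computable_def
    by (intro exI[of _ reduction_machine] exI[of _ p] conjI wf_reduction_machine)
      (auto simp: graph_isomorphism_def)
qed

theorem theorem3:
  shows "\<exists>f. polynomial_time_reduction graph_isomorphism lattice_isomorphism f"
proof -
  have iso: "isomorphic_lattices m (graph_matrix m EG) (graph_matrix m EH) \<longleftrightarrow> isomorphic_graphs n EG EH"
    if "simple_graph n EG" "simple_graph n EH" "m = max 1 n" for m n EG EH
  proof (cases "n = 0")
    \<comment> \<open>Both sides are true: the graphs have no edges, so the identity is an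
      isomorphism, also on the one vertex put in place of none.\<close>
    case True
    with that have "EG = {}" "EH = {}" "m = 1"
      by (auto simp: simple_graph_def)
    moreover have "isomorphic_graphs n {} {}" for n
      unfolding isomorphic_graphs_def by (auto intro: permutes_id)
    ultimately show ?thesis
      using isomorphic_graphs_imp_isomorphic_lattices by blast
  next
    case False
    then have "0 < n" by simp
    moreover from this that(3) have "m = n" by (simp add: max_def)
    ultimately show ?thesis
      using that(1,2) isomorphic_graphs_imp_isomorphic_lattices[of n EG EH]
        isomorphic_lattices_imp_isomorphic_graphs[of n EG EH] by metis
  qed
  have "reduction ` instances graph_isomorphism \<subseteq> instances lattice_isomorphism"
    by (auto simp: graph_isomorphism_def lattice_isomorphism_def reduction_def Let_def rank_graph_matrix)
  moreover have "yes_instance graph_isomorphism x \<longleftrightarrow> yes_instance lattice_isomorphism (reduction x)"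
    if "x \<in> instances graph_isomorphism" for x
    using that iso by (auto simp: graph_isomorphism_def lattice_isomorphism_def reduction_def Let_def)
  ultimately show ?thesis
    unfolding polynomial_time_reduction_def using reduction_computable by blast
qed

end
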